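(* There exist a path $\lambda \in \bigcap_{p>2} C_{p\text{-var}}([0,1],\mathbb{R})$ and a continuous nondecreasing function $\gamma:[0,1]\to\mathbb{R}$ such that the reflected equation $$dZ_t = A Z_t\, d\lambda_t - e_1\, d\gamma_t + e_1\, dK_t,\qquad Z\cdot e_1 \geq 0,\qquad dK = 1_{\{Z\cdot e_1 = 0\}}|dK|$$ admits uncountably many distinct solutions $Z$ on $[0,1]$ with $Z_0 = 0$, each of which satisfies $Z_t \neq 0$ for all $t \in (0,1]$.
   Context: $C_{p\text{-var}}([0,1],\mathbb{R})$ is the set of continuous functions $[0,1]\to\mathbb{R}$ with finite $p$-variation. $(e_1,e_2)$ is the canonical basis of $\mathbb{R}^2$ and $A=\begin{pmatrix}0&1\\1&0\end{pmatrix}$. For a function $f$ of a real variable, $f_{s,t}:=f(t)-f(s)$. Definition of solution. Let $\lambda:[0,1]\to\mathbb{R}$ be continuous and $\gamma:[0,1]\to\mathbb{R}$ cadlag and nondecreasing. A solution of the equation on an interval $I\subset[0,1]$ is a pair $(Z,K)$ with $Z:I\to\mathbb{R}^2$, $K:I\to\mathbb{R}$, $K$ cadlag and nondecreasing, such that $Z_t\cdot e_1\ge 0$ for all $t\in I$, the measure $dK$ is carried by $\{t: Z_t\cdot e_1=0\}$, and for all $s\le t$ in $I$ $$Z_t = e^{A\lambda_{s,t}}Z_s+\int_s^t \big(e^{A\lambda_{u,t}}e_1\big)(dK_u-d\gamma_u),$$ the integral being a Stieltjes integral over $(s,t]$. One says that $Z$ itself is a solution if there exists $K$ such that $(Z,K)$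 is a solution. *)

theory Defs
  imports "HOL-Analysis.Analysis"
begin

definition p_variation_sums :: "real \<Rightarrow> real \<Rightarrow> real \<Rightarrow> (real \<Rightarrow> real) \<Rightarrow> real set" where
  "p_variation_sums p a b f =
    {(\<Sum>i<n. \<bar>f (\<tau> (Suc i)) - f (\<tau> i)\<bar> powr p) | n \<tau>.
      \<tau> 0 = a \<and> \<tau> n = b \<and> strict_mono_on {..n} \<tau>}"

text \<open>Functions on \<open>[a,b]\<close> are represented by functions on the real line; membership
  depends only on the values on \<open>[a,b]\<close>.\<close>

definition C_pvar :: "real \<Rightarrow> real \<Rightarrow> real \<Rightarrow> (real \<Rightarrow> real) set" where
  "C_pvar p a b = {f. continuous_on {a..b} f \<and> bdd_above (p_variation_sums p a b f)}"

definition cadlag_on :: "real set \<Rightarrow> (real \<Rightarrow> real) \<Rightarrow> bool" where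
  "cadlag_on I f \<longleftrightarrow>
    (\<forall>t\<in>I. (f \<longlongrightarrow> f t) (at t within (I \<inter> {t<..})) \<and>
           (\<exists>l. (f \<longlongrightarrow> l) (at t within (I \<inter> {..<t}))))"

text \<open>The Stieltjes measure \<open>dF\<close> on \<open>(s,t]\<close>. Since \<open>interval_measure\<close> wants a nondecreasing
  right-continuous function on the whole line, and \<open>F\<close> is only controlled on an interval
  containing \<open>[s,t]\<close>, \<open>F\<close> is first frozen outside \<open>[s,t]\<close>; the resulting
  measure has no mass outside \<open>(s,t]\<close>.\<close>

definition stieltjes_measure :: "real \<Rightarrow> real \<Rightarrow> (real \<Rightarrow> real) \<Rightarrow> real measure" where
  "stieltjes_measure s t F = interval_measure (\<lambda>u. F (max s (min t u)))"

definition stieltjes_integral ::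
    "real \<Rightarrow> real \<Rightarrow> (real \<Rightarrow> 'a::{banach, second_countable_topology}) \<Rightarrow> (real \<Rightarrow> real) \<Rightarrow> 'a" where
  "stieltjes_integral s t f F = (LINT u:{s<..t}|stieltjes_measure s t F. f u)"

text \<open>The matrix exponential, as a power series; the type of square matrices carries no
  algebra instance to which the generic \<open>exp\<close> would apply.\<close>

definition matrix_exp :: "real^'n^'n \<Rightarrow> real^'n^'n" where
  "matrix_exp M = (\<Sum>k. (1 / fact k) *\<^sub>R (((**) M ^^ k) (mat 1)))"

definition e1 :: "real^2" where
  "e1 = axis 1 1"

definition A_mat :: "real^2^2" where
  "A_mat = vector [vector [0, 1], vector [1, 0]]"

text \<open>For \<open>lam\<close> continuous and \<open>\<gamma>\<close> cadlag and nondecreasing on \<open>[0,1]\<close>. That \<open>dK\<close> is carried by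
  \<open>{Z \<bullet> e1 = 0}\<close> is expressed on every \<open>(s,t]\<close> with \<open>s, t\<close> in \<open>I\<close>, because \<open>K\<close> need not be
  bounded near an end point which is missing from \<open>I\<close>. An initial mass of \<open>K\<close> at the left
  end point of \<open>I\<close> is not seen by \<open>dK\<close>, just as in the equation. The integral against
  \<open>dK - d\<gamma>\<close> is the difference of the two integrals.\<close>

definition reflected_solution_pair ::
    "(real \<Rightarrow> real) \<Rightarrow> (real \<Rightarrow> real) \<Rightarrow> real set \<Rightarrow> (real \<Rightarrow> real^2) \<Rightarrow> (real \<Rightarrow> real) \<Rightarrow> bool" where
  "reflected_solution_pair lam \<gamma> I Z K \<longleftrightarrow>
    is_interval I \<and> I \<subseteq> {0..1} \<and>
    cadlag_on I K \<and> mono_on I K \<and>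
    (\<forall>t\<in>I. Z t \<bullet> e1 \<ge> 0) \<and>
    (\<forall>s\<in>I. \<forall>t\<in>I. s \<le> t \<longrightarrow>
      (AE u in stieltjes_measure s t K. u \<in> {s<..t} \<longrightarrow> Z u \<bullet> e1 = 0)) \<and>
    (\<forall>s\<in>I. \<forall>t\<in>I. s \<le> t \<longrightarrow>
      Z t = matrix_exp ((lam t - lam s) *\<^sub>R A_mat) *v Z s
        + (stieltjes_integral s t (\<lambda>u. matrix_exp ((lam t - lam u) *\<^sub>R A_mat) *v e1) K
           - stieltjes_integral s t (\<lambda>u. matrix_exp ((lam t - lam u) *\<^sub>R A_mat) *v e1) \<gamma>))"

definition reflected_solution ::
    "(real \<Rightarrow> real) \<Rightarrow> (real \<Rightarrow> real) \<Rightarrow> real set \<Rightarrow> (real \<Rightarrow> real^2) \<Rightarrow> bool" where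
  "reflected_solution lam \<gamma> I Z \<longleftrightarrow> (\<exists>K. reflected_solution_pair lam \<gamma> I Z K)"

end

theory Submission
  imports Defs
begin

text \<open>
  Away from the boundary \<open>Z = (x, y)\<close> solves \<open>dx = y dlam - d\<gamma>\<close>, \<open>dy = x dlam\<close>. Start at \<open>(0, \<eta>)\<close> with
  \<open>\<eta> > 0\<close>, let \<open>lam\<close> increase by \<open>\<delta>\<close>, then let \<open>\<gamma>\<close> push \<open>x\<close> back to \<open>0\<close>, then let \<open>lam\<close> decrease by
  \<open>\<delta>\<close> (reflection keeps \<open>x = 0\<close>, so \<open>y\<close> is constant). Such a cycle moves the point to \<open>(0, \<eta> cosh \<delta>)\<close>,
  provided that \<open>\<gamma>\<close> increases by at least \<open>\<eta> sinh \<delta>\<close>. Infinitely many cycles, of heights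
  \<open>\<delta>\<^sub>n\<close>, accumulate at time \<open>0\<close>. If \<open>\<delta>\<^sub>n\<close> is of order \<open>n\<close> to the power \<open>-1/2\<close>, then \<open>lam\<close> has finite
  \<open>p\<close>-variation for all \<open>p > 2\<close>, but the product of the \<open>cosh \<delta>\<^sub>n\<close> diverges, so that a solution can
  leave \<open>0\<close>; its value at time \<open>1\<close> is arbitrary in \<open>(0, 1)\<close>. The constant in \<open>\<delta>\<^sub>n\<close> makes \<open>y\<close> of order
  \<open>n\<close> to the power \<open>-2\<close> at the \<open>n\<close>-th cycle, so that the pushes required of \<open>\<gamma>\<close> are summable.
\<close>

section \<open>Stieltjes integrals of piecewise differentiable integrators\<close>

lemma negligible_countable:
  fixes S :: "real set"
  assumes "countable S"
  shows "negligible S"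
  using countable_imp_null_set_lborel[OF assms]
  by (simp add: negligible_iff_null_sets null_sets_completionI)

text \<open>A Henstock-Kurzweil argument: each term of a fine tagged sum has error at most
  \<open>e\<close> times the increment of \<open>x + J x\<close>, where \<open>J\<close> is bounded
  and jumps at all exceptional points, so the error bounds telescope. The exceptional set may be
  infinite because the kinks of the paths below accumulate at time 0.\<close>

lemma fundamental_theorem_of_calculus_countable:
  fixes f :: "real \<Rightarrow> 'a::banach"
  assumes "a \<le> b" and "countable S" and cont: "continuous_on {a..b} f"
    and der: "\<And>x. x \<in> {a<..<b} - S \<Longrightarrow> (f has_vector_derivative f' x) (at x)"
  shows "(f' has_integral (f b - f a)) {a..b}"
proof -
  \<comment> \<open>No derivative is assumed at \<open>a\<close> and \<open>b\<close>, so they are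
    exceptional as well. They also make \<open>S'\<close> nonempty, hence enumerated by
    \<open>s\<close>, possibly with repetitions.\<close>
  define S' where "S' = S \<union> {a, b}"
  define s where "s = from_nat_into S'"
  have s: "range s = S'"
    unfolding s_def S'_def by (rule range_from_nat_into) (use \<open>countable S\<close> in auto)
  define g where "g = (\<lambda>x. if x \<in> S' then 0 else f' x)"
  \<comment> \<open>\<open>J\<close> increases by at least \<open>2\<^sup>-\<^sup>i\<close> over every interval containing \<open>s i\<close>, even as an end point; this
    pays for the oscillation of \<open>f\<close> on the intervals tagged by \<open>s i\<close>.\<close>
  define j where "j = (\<lambda>x i. (1/2)^i * ((if s i < x then 1 else 0) + (if s i \<le> x then 1 else (0::real))))"
  define J where "J = (\<lambda>x. \<Sum>i. j x i)"
  have geo: "summable (\<lambda>i. (1/2)^i * (2::real))"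
    by (intro summable_mult2 summable_geometric) auto
  have j_le: "0 \<le> j x i" "j x i \<le> (1/2)^i * 2" for x i
    by (auto simp: j_def)
  have j_sum: "summable (j x)" for x
    by (rule summable_comparison_test'[OF geo, of 0]) (use j_le in auto)
  have J_bound: "0 \<le> J x" "J x \<le> 4" for x
  proof -
    show "0 \<le> J x" unfolding J_def using j_sum j_le by (intro suminf_nonneg) auto
    have "J x \<le> (\<Sum>i. (1/2)^i * (2::real))"
      unfolding J_def using j_sum j_le geo by (intro suminf_le) auto
    also have "\<dots> = 4" by (subst suminf_mult2[symmetric]) (auto simp: suminf_geometric)
    finally show "J x \<le> 4" .
  qed
  have J_mono: "J u \<le> J v" if "u \<le> v" for u v
    unfolding J_def using j_sum that by (intro suminf_le) (auto simp: j_def)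
  have J_jump: "J u + (1/2)^i \<le> J v" if "u < v" "u \<le> s i" "s i \<le> v" for u v i
  proof -
    have sm: "summable (\<lambda>k. if k = i then (1/2)^i else (0::real))"
      using sums_single[of i "\<lambda>_. (1/2)^i"] by (simp add: sums_iff)
    have "J u + (1/2)^i = (\<Sum>k. j u k + (if k = i then (1/2)^i else 0))"
      unfolding J_def using sums_single[of i "\<lambda>_. (1/2::real)^i"] j_sum sm
      by (subst suminf_add[symmetric]) (auto simp: sums_iff)
    also have "\<dots> \<le> J v"
      unfolding J_def using that j_sum sm
      by (intro suminf_le summable_add) (auto simp: j_def)
    finally show ?thesis .
  qed
  have int: "(g has_integral (f b - f a)) (cbox a b)"
    unfolding has_integral
  proof safe
    fix e0 :: real assume "e0 > 0"
    \<comment> \<open>\<open>x + J x\<close> grows by at most \<open>b - a + 4\<close> over the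
      interval; the 5 makes the final inequality strict.\<close>
    define e where "e = e0 / (b - a + 5)"
    have e: "e > 0" using \<open>e0 > 0\<close> \<open>a \<le> b\<close> by (simp add: e_def)
    \<comment> \<open>At an exceptional tag the jump of \<open>J\<close> pays for the oscillation of
      \<open>f\<close>; at any other tag differentiability does.\<close>
    have "\<exists>d>0. \<forall>u v. u \<in> {a..b} \<longrightarrow> v \<in> {a..b} \<longrightarrow> u \<le> x \<longrightarrow> x \<le> v \<longrightarrow> \<bar>u - x\<bar> < d \<longrightarrow> \<bar>v - x\<bar> < d \<longrightarrow>
        norm ((v - u) *\<^sub>R g x - (f v - f u)) \<le> e * ((v + J v) - (u + J u))" for x
    proof (cases "x \<in> S'")
      case True
      then obtain i where i: "x = s i" using s by auto
      show ?thesis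
      proof (cases "x \<in> {a..b}")
        case x: True
        from cont[unfolded continuous_on_iff, rule_format, OF x, of "e * (1/2)^i / 2"] e
        obtain d where d: "d > 0" "\<And>y. y \<in> {a..b} \<Longrightarrow> dist y x < d \<Longrightarrow> dist (f y) (f x) < e * (1/2)^i / 2"
          by auto
        show ?thesis
        proof (intro exI[of _ d] conjI d(1) allI impI)
          fix u v assume h: "u \<in> {a..b}" "v \<in> {a..b}" "u \<le> x" "x \<le> v" "\<bar>u - x\<bar> < d" "\<bar>v - x\<bar> < d"
          show "norm ((v - u) *\<^sub>R g x - (f v - f u)) \<le> e * ((v + J v) - (u + J u))"
          proof (cases "u = v")
            case False
            then have "u < v" using h by auto
            have "norm (f v - f u) \<le> e * (1/2)^i"
              using d(2)[of u] d(2)[of v] h norm_triangle_ineq4[of "f v - f x" "f u - f x"]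
              by (auto simp: dist_norm)
            also have "\<dots> \<le> e * ((v + J v) - (u + J u))"
              using J_jump[OF \<open>u < v\<close>, of i] h i e \<open>u < v\<close> by (intro mult_left_mono) auto
            finally show ?thesis using True by (simp add: g_def norm_minus_commute)
          qed auto
        qed
      qed (auto intro!: exI[of _ 1])
    next
      case False
      show ?thesis
      proof (cases "x \<in> {a..b}")
        case True
        then have "x \<in> {a<..<b} - S" using False by (auto simp: S'_def less_le)
        from der[OF this, unfolded has_vector_derivative_def has_derivative_at_alt] e
        obtain d where d: "d > 0" "\<And>y. norm (y - x) < d \<Longrightarrow> norm (f y - f x - (y - x) *\<^sub>R f' x) \<le> e * norm (y - x)"
          by blast
        show ?thesis
        proof (intro exI[of _ d] conjI d(1) allI impI)
          fix u v assume h: "u \<in> {a..b}" "v \<in> {a..b}" "u \<le> x" "x \<le> v" "\<bar>u - x\<bar> < d" "\<bar>v - x\<bar> < d"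
          \<comment> \<open>Both ends are compared with the tag between them, so the two errors add
            up to a multiple of \<open>v - u\<close>.\<close>
          have "(v - u) *\<^sub>R f' x - (f v - f u)
              = (f u - f x - (u - x) *\<^sub>R f' x) - (f v - f x - (v - x) *\<^sub>R f' x)"
            by (simp add: algebra_simps)
          then have "norm ((v - u) *\<^sub>R f' x - (f v - f u))
              \<le> norm (f u - f x - (u - x) *\<^sub>R f' x) + norm (f v - f x - (v - x) *\<^sub>R f' x)"
            by (simp only: norm_triangle_ineq4)
          also have "\<dots> \<le> e * (x - u) + e * (v - x)"
            using d(2)[of u] d(2)[of v] h by (intro add_mono) auto
          also have "\<dots> = e * (v - u)" by (simp add: algebra_simps)
          also have "\<dots> \<le> e * ((v + J v) - (u + J u))"
            using J_mono[of u v] h e by (intro mult_left_mono) auto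
          finally show "norm ((v - u) *\<^sub>R g x - (f v - f u)) \<le> e * ((v + J v) - (u + J u))"
            using False by (simp add: g_def)
        qed
      qed (auto intro!: exI[of _ 1])
    qed
    then obtain d where d: "\<And>x. d x > 0"
      "\<And>x u v. \<lbrakk>u \<in> {a..b}; v \<in> {a..b}; u \<le> x; x \<le> v; \<bar>u - x\<bar> < d x; \<bar>v - x\<bar> < d x\<rbrakk> \<Longrightarrow>
        norm ((v - u) *\<^sub>R g x - (f v - f u)) \<le> e * ((v + J v) - (u + J u))"
      by metis
    show "\<exists>\<gamma>. gauge \<gamma> \<and> (\<forall>\<D>. \<D> tagged_division_of cbox a b \<and> \<gamma> fine \<D> \<longrightarrow>
        norm ((\<Sum>(x,K)\<in>\<D>. measure lborel K *\<^sub>R g x) - (f b - f a)) < e0)"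
    proof (rule exI, safe)
      show "gauge (\<lambda>x. ball x (d x))"
        using d(1) gauge_ball_dependent by blast
    next
      fix p assume p: "p tagged_division_of cbox a b" and fine: "(\<lambda>x. ball x (d x)) fine p"
      have eqs: "(b + J b) - (a + J a) = (\<Sum>(x,K)\<in>p. (Sup K + J (Sup K)) - (Inf K + J (Inf K)))"
        "f b - f a = (\<Sum>(x,K)\<in>p. f (Sup K) - f (Inf K))"
        using additive_tagged_division_1[where f = "\<lambda>x. x + J x"] additive_tagged_division_1[where f = f]
          \<open>a \<le> b\<close> p by auto
      have "norm (\<Sum>(x,K)\<in>p. measure lborel K *\<^sub>R g x - (f (Sup K) - f (Inf K)))
          \<le> (\<Sum>n\<in>p. e * (case n of (x,K) \<Rightarrow> (Sup K + J (Sup K)) - (Inf K + J (Inf K))))"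
      proof (rule sum_norm_le, safe)
        fix x K assume xK: "(x, K) \<in> p"
        then obtain u v where k: "K = cbox u v" and x: "x \<in> K" and kab: "K \<subseteq> cbox a b"
          using p by (metis tagged_division_ofD(2) tagged_division_ofD(3) tagged_division_ofD(4))
        have "u \<le> v" using x k by auto
        have "K \<subseteq> ball x (d x)" using fine xK by blast
        then have "u \<in> ball x (d x)" "v \<in> ball x (d x)" using \<open>u \<le> v\<close> k by auto
        then show "norm (measure lborel K *\<^sub>R g x - (f (Sup K) - f (Inf K)))
            \<le> e * ((Sup K + J (Sup K)) - (Inf K + J (Inf K)))"
          using d(2)[of u v x] x k kab \<open>u \<le> v\<close> by (auto simp: dist_real_def abs_minus_commute)
      qed
      also have "\<dots> = e * ((b + J b) - (a + J a))"
        by (simp add: eqs sum_distrib_left)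
      also have "\<dots> \<le> e * (b - a + 4)"
        using J_bound[of a] J_bound[of b] e by (intro mult_left_mono) auto
      also have "\<dots> < e * (b - a + 5)"
        using e by (intro mult_strict_left_mono) auto
      also have "\<dots> = e0" using \<open>a \<le> b\<close> by (simp add: e_def)
      finally show "norm ((\<Sum>(x,K)\<in>p. measure lborel K *\<^sub>R g x) - (f b - f a)) < e0"
        by (simp add: eqs split_def sum_subtractf)
    qed
  qed
  have neg: "negligible S'"
    using \<open>countable S\<close> by (intro negligible_countable) (auto simp: S'_def)
  have "(f' has_integral (f b - f a)) (cbox a b)"
    by (rule has_integral_spike[OF neg _ int]) (simp add: g_def)
  then show ?thesis by simp
qed

text \<open>By the fundamental theorem above, both measures give \<open>{a<..b}\<close> the mass
  \<open>F b - F a\<close>. These intervals generate the Borel sets and are stable under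
  intersection, and countably many of finite mass cover the line.\<close>

lemma interval_measure_eq_density:
  fixes F f :: "real \<Rightarrow> real"
  assumes cont: "continuous_on UNIV F" and mono: "mono F" and "countable S"
    and der: "\<And>x. x \<notin> S \<Longrightarrow> (F has_real_derivative f x) (at x)"
    and nonneg: "\<And>x. 0 \<le> f x" and meas: "f \<in> borel_measurable borel"
  shows "interval_measure F = density lborel f"
proof -
  have rc: "continuous (at_right a) F" for a
    using cont by (metis continuous_at_imp_continuous_within continuous_on_eq_continuous_at open_UNIV UNIV_I)
  have le: "x \<le> y \<Longrightarrow> F x \<le> F y" for x y using mono by (auto simp: mono_def)
  have I: "emeasure (interval_measure F) {a<..b} = emeasure (density lborel f) {a<..b}" for a b
  proof (cases "a \<le> b")
    case True
    have "(f has_integral (F b - F a)) {a..b}"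
      using True \<open>countable S\<close> der
      by (intro fundamental_theorem_of_calculus_countable[where S = S])
        (auto simp: has_real_derivative_iff_has_vector_derivative intro: continuous_on_subset[OF cont])
    then have "(f has_integral (F b - F a)) {a<..b}"
      by (subst has_integral_spike_set_eq[of _ "{a..b}"]) (auto intro: negligible_subset[of "{a}"])
    then have "((\<lambda>x. if x \<in> {a<..b} then f x else 0) has_integral (F b - F a)) UNIV"
      by (simp only: has_integral_restrict_UNIV)
    then have "((\<lambda>x. f x * indicator {a<..b} x) has_integral (F b - F a)) UNIV"
      by (rule has_integral_eq[rotated]) (auto simp: indicator_def)
    then have "(\<integral>\<^sup>+x. ennreal (f x * indicator {a<..b} x) \<partial>lborel) = F b - F a"
      using meas nonneg by (intro nn_integral_has_integral_lborel) (auto simp: indicator_def)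
    moreover have "emeasure (density lborel f) {a<..b} = (\<integral>\<^sup>+x. ennreal (f x * indicator {a<..b} x) \<partial>lborel)"
      using meas by (subst emeasure_density) (auto simp: ennreal_mult' nonneg ennreal_indicator)
    ultimately show ?thesis using emeasure_interval_measure_Ioc[OF True le rc] by simp
  qed auto
  show ?thesis
  proof (rule measure_eqI_generator_eq[where \<Omega>=UNIV])
    fix X assume "X \<in> range (\<lambda>(a, b). {a<..b::real})"
    then show "emeasure (interval_measure F) X = emeasure (density lborel f) X" using I by auto
  next
    show "range (\<lambda>i. {-real i<..real i}) \<subseteq> range (\<lambda>(a, b). {a<..b::real})" by auto
    show "(\<Union>i. {-real i<..real i}) = UNIV"
    proof -
      have "\<exists>i. - real i < x \<and> x \<le> real i" for x
        using reals_Archimedean2[of "\<bar>x\<bar>"] by (metis abs_less_iff less_imp_le minus_less_iff)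
      then show ?thesis by auto
    qed
    show "emeasure (interval_measure F) {-real i<..real i} \<noteq> \<infinity>" for i
      by (subst emeasure_interval_measure_Ioc[OF _ le rc]) auto
  qed (auto simp: borel_sigma_sets_Ioc Int_stable_def)
qed

text \<open>The values of \<open>f\<close> on \<open>S\<close> and outside the open interval are
  uncontrolled, so 0 replaces them. For the integrators below this is, off a countable set, the
  derivative of the integrator frozen outside \<open>[s,t]\<close>.\<close>

definition stieltjes_density :: "real \<Rightarrow> real \<Rightarrow> real set \<Rightarrow> (real \<Rightarrow> real) \<Rightarrow> real \<Rightarrow> real" where
  "stieltjes_density s t S f u = (if u \<in> {s<..<t} - S then f u else 0)"

context
  fixes F f :: "real \<Rightarrow> real" and s t :: real and S :: "real set"
  assumes st: "s \<le> t" and cont: "continuous_on {s..t} F" and mono: "mono_on {s..t} F"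
    and S: "countable S"
    and der: "\<And>u. u \<in> {s<..<t} - S \<Longrightarrow> (F has_real_derivative f u) (at u)"
begin

lemma stieltjes_density_nonneg: "0 \<le> stieltjes_density s t S f u"
  using mono_on_imp_deriv_nonneg[OF mono der, of u]
  by (auto simp: stieltjes_density_def)

private definition "G u = F (max s (min t u))"

private lemma G_cont: "continuous_on UNIV G"
  unfolding G_def by (rule continuous_on_compose2[OF cont]) (use st in \<open>auto intro!: continuous_intros\<close>)

private lemma G_mono: "mono G"
  using st by (auto simp: G_def intro!: monoI mono_onD[OF mono])

private lemma G_der:
  assumes "u \<notin> S \<union> {s, t}"
  shows "(G has_real_derivative stieltjes_density s t S f u) (at u)"
proof -
  consider "u < s" | "u > t" | "u \<in> {s<..<t} - S" using assms by fastforce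
  then show ?thesis
  proof cases
    case 1
    have "(G has_real_derivative 0) (at u)"
      by (rule has_field_derivative_transform_within_open[of "\<lambda>_. F s" _ _ "{..<s}"])
        (use 1 st in \<open>auto simp: G_def max_def min_def\<close>)
    then show ?thesis using 1 by (simp add: stieltjes_density_def)
  next
    case 2
    have "(G has_real_derivative 0) (at u)"
      by (rule has_field_derivative_transform_within_open[of "\<lambda>_. F t" _ _ "{t<..}"])
        (use 2 st in \<open>auto simp: G_def max_def min_def\<close>)
    then show ?thesis using 2 by (simp add: stieltjes_density_def)
  next
    case 3
    have "(G has_real_derivative f u) (at u)"
      by (rule has_field_derivative_transform_within_open[OF der[OF 3], of "{s<..<t}"])
        (use 3 in \<open>auto simp: G_def\<close>)
    then show ?thesis using 3 by (simp add: stieltjes_density_def)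
  qed
qed

text \<open>Measurability of \<open>f\<close> is not assumed: the density is a pointwise limit of
  difference quotients of the continuous \<open>G\<close>, cut off to a Borel set.\<close>

lemma stieltjes_density_measurable: "stieltjes_density s t S f \<in> borel_measurable borel"
proof (rule borel_measurable_LIMSEQ_real)
  have [measurable]: "G \<in> borel_measurable borel"
    by (rule borel_measurable_continuous_onI[OF G_cont])
  have [measurable]: "{s<..<t} - S \<in> sets borel"
    using S by (intro sets.Diff[OF borel_open sets.countable]) auto
  show "(\<lambda>u. indicator ({s<..<t} - S) u * ((G (u + inverse (real (Suc n))) - G u) / inverse (real (Suc n))))
      \<in> borel_measurable borel" for n by measurable
  fix u
  show "(\<lambda>n. indicator ({s<..<t} - S) u * ((G (u + inverse (real (Suc n))) - G u) / inverse (real (Suc n))))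
      \<longlonglongrightarrow> stieltjes_density s t S f u"
  proof (cases "u \<in> {s<..<t} - S")
    case True
    then have "((\<lambda>h. (G (u + h) - G u) / h) \<longlongrightarrow> stieltjes_density s t S f u) (at 0)"
      using G_der[of u] by (auto simp: DERIV_def)
    moreover have "filterlim (\<lambda>n. inverse (real (Suc n))) (at 0) sequentially"
      using LIMSEQ_inverse_real_of_nat by (auto simp: filterlim_at)
    ultimately have "(\<lambda>n. (G (u + inverse (real (Suc n))) - G u) / inverse (real (Suc n)))
        \<longlonglongrightarrow> stieltjes_density s t S f u"
      by (rule filterlim_compose)
    then show ?thesis using True by simp
  qed (auto simp: stieltjes_density_def)
qed

lemma stieltjes_measure_eq_density:
  "stieltjes_measure s t F = density lborel (stieltjes_density s t S f)"
  unfolding stieltjes_measure_def G_def[symmetric]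
  using G_cont G_mono S G_der stieltjes_density_nonneg stieltjes_density_measurable
  by (intro interval_measure_eq_density[where S = "S \<union> {s, t}"]) auto

text \<open>The density turns the Stieltjes integral into a Lebesgue integral, absolutely convergent
  because \<open>\<phi>\<close> is bounded on \<open>[s,t]\<close>. Passing from the density to
  \<open>f\<close> changes the integrand on a countable set only.\<close>

lemma has_integral_stieltjes:
  fixes \<phi> :: "real \<Rightarrow> 'a::euclidean_space"
  assumes \<phi>: "continuous_on {s..t} \<phi>"
  shows "((\<lambda>u. f u *\<^sub>R \<phi> u) has_integral stieltjes_integral s t \<phi> F) {s..t}"
proof -
  let ?g = "stieltjes_density s t S f"
  let ?h = "\<lambda>u. indicator {s..t} u *\<^sub>R \<phi> u"
  note [measurable] = stieltjes_density_measurable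
  have h[measurable]: "?h \<in> borel_measurable borel"
    using \<phi> by (intro borel_measurable_continuous_on_indicator) auto
  have "(?g has_integral (F t - F s)) {s..t}"
    using st S cont der
    by (intro fundamental_theorem_of_calculus_countable[where S = S])
      (auto simp: has_real_derivative_iff_has_vector_derivative[symmetric] stieltjes_density_def)
  then have "(?g has_integral (F t - F s)) UNIV"
    by (rule has_integral_on_superset) (auto simp: stieltjes_density_def)
  then have "integral\<^sup>N lborel ?g = F t - F s"
    by (rule nn_integral_has_integral_lborel[OF stieltjes_density_measurable stieltjes_density_nonneg])
  then have g: "integrable lborel ?g"
    by (intro integrableI_nonneg) (auto simp: stieltjes_density_nonneg)
  obtain B where B: "\<And>u. u \<in> {s..t} \<Longrightarrow> norm (\<phi> u) \<le> B"
    using compact_imp_bounded[OF compact_continuous_image[OF \<phi> compact_Icc]]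
    unfolding bounded_iff by blast
  have int: "integrable lborel (\<lambda>u. ?g u *\<^sub>R ?h u)"
  proof (rule Bochner_Integration.integrable_bound)
    show "integrable lborel (\<lambda>u. B * ?g u)" using g by simp
    show "AE u in lborel. norm (?g u *\<^sub>R ?h u) \<le> norm (B * ?g u)"
    proof (rule AE_I2)
      fix u
      show "norm (?g u *\<^sub>R ?h u) \<le> norm (B * ?g u)"
        using B[of u] stieltjes_density_nonneg[of u]
        by (cases "u \<in> {s..t}") (auto simp: abs_mult mult.commute intro!: mult_right_mono)
    qed
  qed measurable
  have hm: "(\<lambda>u. indicator {s<..t} u *\<^sub>R ?h u) \<in> borel_measurable lborel"
    unfolding measurable_lborel2 by (rule borel_measurable_scaleR[OF _ h]) simp
  have "stieltjes_integral s t \<phi> F = (LINT u|density lborel ?g. indicator {s<..t} u *\<^sub>R ?h u)"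
    unfolding stieltjes_integral_def stieltjes_measure_eq_density set_lebesgue_integral_def
    by (intro Bochner_Integration.integral_cong) (auto simp: indicator_def)
  also have "\<dots> = (LINT u|lborel. ?g u *\<^sub>R (indicator {s<..t} u *\<^sub>R ?h u))"
    by (rule integral_density[OF hm]) (simp_all add: stieltjes_density_nonneg)
  also have "\<dots> = (LINT u|lborel. ?g u *\<^sub>R ?h u)"
    by (intro Bochner_Integration.integral_cong) (auto simp: indicator_def stieltjes_density_def)
  finally have "((\<lambda>u. ?g u *\<^sub>R ?h u) has_integral stieltjes_integral s t \<phi> F) UNIV"
    using has_integral_integral_lborel[OF int] by simp
  then have "((\<lambda>u. if u \<in> {s..t} then ?g u *\<^sub>R \<phi> u else 0) has_integral stieltjes_integral s t \<phi> F) UNIV"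
    by (rule has_integral_eq[rotated]) (auto simp: indicator_def)
  then have int': "((\<lambda>u. ?g u *\<^sub>R \<phi> u) has_integral stieltjes_integral s t \<phi> F) {s..t}"
    by (simp only: has_integral_restrict_UNIV)
  have neg: "negligible (S \<union> {s, t})"
    using S by (intro negligible_countable) auto
  show ?thesis
    by (rule has_integral_spike[OF neg _ int']) (auto simp: stieltjes_density_def)
qed

end

section \<open>A differential criterion for reflected solutions\<close>

lemma A_mat_vec: "A_mat *v v = vector [v $ 2, v $ 1]"
  by (simp add: vec_eq_iff forall_2 A_mat_def matrix_vector_mult_def sum_2)

lemma matrix_power_A_mat:
  "((**) (r *\<^sub>R A_mat) ^^ k) (mat 1) = (r ^ k) *\<^sub>R (if even k then mat 1 else A_mat)"
  by (induction k) (auto simp: vec_eq_iff forall_2 A_mat_def matrix_matrix_mult_def mat_def sum_2)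

text \<open>Since \<open>A_mat\<close> squares to the identity, the even powers sum to the cosh term
  and the odd powers to the sinh term.\<close>

lemma matrix_exp_A_mat: "matrix_exp (r *\<^sub>R A_mat) = cosh r *\<^sub>R mat 1 + sinh r *\<^sub>R A_mat"
proof -
  have "(\<lambda>k. (if even k then r ^ k /\<^sub>R fact k else 0) *\<^sub>R (mat 1 :: real^2^2)
          + (if even k then 0 else r ^ k /\<^sub>R fact k) *\<^sub>R A_mat)
      sums (cosh r *\<^sub>R mat 1 + sinh r *\<^sub>R A_mat)"
    by (intro sums_add sums_scaleR_left cosh_converges sinh_converges)
  also have "(\<lambda>k. (if even k then r ^ k /\<^sub>R fact k else 0) *\<^sub>R (mat 1 :: real^2^2)
          + (if even k then 0 else r ^ k /\<^sub>R fact k) *\<^sub>R A_mat)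
      = (\<lambda>k. (1 / fact k) *\<^sub>R (((**) (r *\<^sub>R A_mat) ^^ k) (mat 1)))"
    by (auto simp: matrix_power_A_mat fun_eq_iff field_simps)
  finally show ?thesis by (simp add: matrix_exp_def sums_iff)
qed

lemma matrix_exp_A_mat_vec:
  "matrix_exp (r *\<^sub>R A_mat) *v v = vector [cosh r * v $ 1 + sinh r * v $ 2, sinh r * v $ 1 + cosh r * v $ 2]"
  by (simp add: vec_eq_iff forall_2 matrix_exp_A_mat matrix_vector_mult_add_rdistrib
      A_mat_vec flip: scaleR_matrix_vector_assoc)

lemma has_vector_derivative_vector2:
  fixes f g :: "real \<Rightarrow> real"
  assumes "(f has_real_derivative f') F" "(g has_real_derivative g') F"
  shows "((\<lambda>u. vector [f u, g u] :: real^2) has_vector_derivative vector [f', g']) F"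
proof -
  have eq: "vector [p, q] = p *\<^sub>R axis 1 1 + q *\<^sub>R (axis 2 1 :: real^2)" for p q :: real
    by (simp add: vec_eq_iff forall_2 axis_def)
  show ?thesis
    unfolding eq using assms[unfolded has_real_derivative_iff_has_vector_derivative]
    by (intro has_vector_derivative_add bounded_linear.has_vector_derivative[OF bounded_linear_scaleR_left])
qed

lemma continuous_on_vector2:
  fixes f g :: "real \<Rightarrow> real"
  assumes "continuous_on T f" "continuous_on T g"
  shows "continuous_on T (\<lambda>u. vector [f u, g u] :: real^2)"
proof -
  have eq: "vector [p, q] = p *\<^sub>R axis 1 1 + q *\<^sub>R (axis 2 1 :: real^2)" for p q :: real
    by (simp add: vec_eq_iff forall_2 axis_def)
  show ?thesis unfolding eq using assms by (intro continuous_intros)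
qed

lemma cadlag_on_continuous:
  assumes "continuous_on I f"
  shows "cadlag_on I f"
  unfolding cadlag_on_def
proof (intro ballI conjI)
  fix t assume t: "t \<in> I"
  have lim: "(f \<longlongrightarrow> f t) (at t within I \<inter> J)" for J
    using assms t unfolding continuous_on_def by (intro tendsto_within_subset[OF _ Int_lower1]) auto
  show "(f \<longlongrightarrow> f t) (at t within I \<inter> {t<..})" by (rule lim)
  show "\<exists>l. (f \<longlongrightarrow> l) (at t within I \<inter> {..<t})" using lim by blast
qed

text \<open>Variation of constants: transporting \<open>(x, y)\<close> from time \<open>u\<close> to
  time \<open>t\<close> by the exponential gives a curve whose derivative is \<open>k - g\<close>
  times the transported \<open>e1\<close>. Its integral is the Stieltjes equation, and
  \<open>k * x t = 0\<close> makes dK vanish where \<open>x\<close> is positive.\<close>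

lemma reflected_solution_pairI:
  fixes lam \<gamma> K x y :: "real \<Rightarrow> real"
  assumes cont: "continuous_on {0..1} lam" "continuous_on {0..1} \<gamma>" "continuous_on {0..1} K"
      "continuous_on {0..1} x" "continuous_on {0..1} y"
    and mono: "mono_on {0..1} \<gamma>" "mono_on {0..1} K"
    and S: "countable S"
    and der: "\<And>t. t \<in> {0<..<1} - S \<Longrightarrow> \<exists>l g k.
        (lam has_real_derivative l) (at t) \<and> (\<gamma> has_real_derivative g) (at t) \<and>
        (K has_real_derivative k) (at t) \<and>
        (x has_real_derivative (y t * l + k - g)) (at t) \<and>
        (y has_real_derivative (x t * l)) (at t) \<and> k * x t = 0"
    and x: "\<And>t. t \<in> {0..1} \<Longrightarrow> 0 \<le> x t"
    and Z: "\<And>t. t \<in> {0..1} \<Longrightarrow> Z t = vector [x t, y t]"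
  shows "reflected_solution_pair lam \<gamma> {0..1} Z K"
proof -
  \<comment> \<open>Derivatives are unique, so \<open>deriv\<close> turns the pointwise witnesses
    into functions of time.\<close>
  define l g k where "l = deriv lam" and "g = deriv \<gamma>" and "k = deriv K"
  have der:
    "(lam has_real_derivative l t) (at t)" "(\<gamma> has_real_derivative g t) (at t)"
    "(K has_real_derivative k t) (at t)" "(x has_real_derivative (y t * l t + k t - g t)) (at t)"
    "(y has_real_derivative (x t * l t)) (at t)" "k t * x t = 0"
    if t: "t \<in> {0<..<1} - S" for t
  proof -
    obtain l' g' k' where
      d: "(lam has_real_derivative l') (at t)" "(\<gamma> has_real_derivative g') (at t)"
      "(K has_real_derivative k') (at t)" "(x has_real_derivative (y t * l' + k' - g')) (at t)"
      "(y has_real_derivative (x t * l')) (at t)" "k' * x t = 0"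
      using der[OF t] by blast
    moreover have "l t = l'" "g t = g'" "k t = k'"
      unfolding l_def g_def k_def using d(1-3) by (simp_all add: DERIV_imp_deriv)
    ultimately show "(lam has_real_derivative l t) (at t)" "(\<gamma> has_real_derivative g t) (at t)"
      "(K has_real_derivative k t) (at t)" "(x has_real_derivative (y t * l t + k t - g t)) (at t)"
      "(y has_real_derivative (x t * l t)) (at t)" "k t * x t = 0"
      by simp_all
  qed
  have carried: "AE u in stieltjes_measure s t K. u \<in> {s<..t} \<longrightarrow> Z u \<bullet> e1 = 0"
    if st: "s \<in> {0..1}" "t \<in> {0..1}" "s \<le> t" for s t
  proof -
    have sub: "{s..t} \<subseteq> {0..1}" using st by auto
    note hyps = \<open>s \<le> t\<close> continuous_on_subset[OF cont(3) sub] mono_on_subset[OF mono(2) sub] S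
    have dK: "\<And>u. u \<in> {s<..<t} - S \<Longrightarrow> (K has_real_derivative k u) (at u)"
      using der(3) st by auto
    have eq: "stieltjes_measure s t K = density lborel (stieltjes_density s t S k)"
      by (rule stieltjes_measure_eq_density[OF hyps dK])
    \<comment> \<open>The density is positive only where \<open>k\<close> is, and there
      complementarity forces \<open>x u = 0\<close>.\<close>
    have zero: "Z u \<bullet> e1 = 0" if "stieltjes_density s t S k u > 0" for u
    proof -
      have "u \<in> {s<..<t} - S" "k u > 0"
        using that by (auto simp: stieltjes_density_def split: if_splits)
      then have "x u = 0" "u \<in> {0..1}" using der(6)[of u] st by auto
      then show ?thesis using Z by (simp add: e1_def inner_axis)
    qed
    have [measurable]: "stieltjes_density s t S k \<in> borel_measurable borel"
      by (rule stieltjes_density_measurable[OF hyps dK])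
    show ?thesis unfolding eq using zero by (subst AE_density) auto
  qed
  have eqn: "Z t = matrix_exp ((lam t - lam s) *\<^sub>R A_mat) *v Z s
        + (stieltjes_integral s t (\<lambda>u. matrix_exp ((lam t - lam u) *\<^sub>R A_mat) *v e1) K
           - stieltjes_integral s t (\<lambda>u. matrix_exp ((lam t - lam u) *\<^sub>R A_mat) *v e1) \<gamma>)"
    if st: "s \<in> {0..1}" "t \<in> {0..1}" "s \<le> t" for s t
  proof -
    have sub: "{s..t} \<subseteq> {0..1}" using st by auto
    note cont' = cont[THEN continuous_on_subset, OF sub] and mono' = mono[THEN mono_on_subset, OF sub]
    define \<phi> where "\<phi> = (\<lambda>u. matrix_exp ((lam t - lam u) *\<^sub>R A_mat) *v e1)"
    have \<phi>: "\<phi> = (\<lambda>u. vector [cosh (lam t - lam u), sinh (lam t - lam u)])"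
      by (simp add: \<phi>_def matrix_exp_A_mat_vec e1_def axis_def fun_eq_iff)
    \<comment> \<open>\<open>w1\<close> and \<open>w2\<close> are the coordinates of
      \<open>matrix_exp ((lam t - lam u) *\<^sub>R A_mat) *v Z u\<close>, which is
      \<open>Z t\<close> at \<open>u = t\<close>.\<close>
    define w1 where "w1 = (\<lambda>u. cosh (lam t - lam u) * x u + sinh (lam t - lam u) * y u)"
    define w2 where "w2 = (\<lambda>u. sinh (lam t - lam u) * x u + cosh (lam t - lam u) * y u)"
    define W where "W = (\<lambda>u. vector [w1 u, w2 u] :: real^2)"
    have \<phi>_cont: "continuous_on {s..t} \<phi>"
      unfolding \<phi> by (intro continuous_on_vector2 continuous_intros cont')
    have W_cont: "continuous_on {s..t} W"
      unfolding W_def w1_def w2_def by (intro continuous_on_vector2 continuous_intros cont')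
    have W_der: "(W has_vector_derivative (k u *\<^sub>R \<phi> u - g u *\<^sub>R \<phi> u)) (at u)" if u: "u \<in> {s<..<t} - S" for u
    proof -
      have u': "u \<in> {0<..<1} - S" using u st by auto
      note D = der(1)[OF u'] der(4)[OF u'] der(5)[OF u']
      \<comment> \<open>The derivative of \<open>lam\<close> cancels: the exponential undoes the
        motion of \<open>(x, y)\<close> that is due to \<open>lam\<close>.\<close>
      have "(w1 has_real_derivative (k u - g u) * cosh (lam t - lam u)) (at u)"
        unfolding w1_def by (rule derivative_eq_intros D refl | simp add: algebra_simps)+
      moreover have "(w2 has_real_derivative (k u - g u) * sinh (lam t - lam u)) (at u)"
        unfolding w2_def by (rule derivative_eq_intros D refl | simp add: algebra_simps)+
      ultimately have "(W has_vector_derivative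
          vector [(k u - g u) * cosh (lam t - lam u), (k u - g u) * sinh (lam t - lam u)]) (at u)"
        unfolding W_def by (rule has_vector_derivative_vector2)
      also have "vector [(k u - g u) * cosh (lam t - lam u), (k u - g u) * sinh (lam t - lam u)]
          = k u *\<^sub>R \<phi> u - g u *\<^sub>R \<phi> u"
        by (simp add: \<phi> vec_eq_iff forall_2 algebra_simps)
      finally show ?thesis .
    qed
    have "((\<lambda>u. k u *\<^sub>R \<phi> u - g u *\<^sub>R \<phi> u) has_integral W t - W s) {s..t}"
      using fundamental_theorem_of_calculus_countable[OF \<open>s \<le> t\<close> S W_cont W_der] .
    moreover have "((\<lambda>u. k u *\<^sub>R \<phi> u - g u *\<^sub>R \<phi> u) has_integral
        (stieltjes_integral s t \<phi> K - stieltjes_integral s t \<phi> \<gamma>)) {s..t}"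
      using st der(2,3) by (intro has_integral_diff has_integral_stieltjes[OF \<open>s \<le> t\<close>, where S = S] cont' mono' S \<phi>_cont) auto
    ultimately have "W t - W s = stieltjes_integral s t \<phi> K - stieltjes_integral s t \<phi> \<gamma>"
      by (rule has_integral_unique)
    moreover have "W t = Z t" using Z st by (simp add: W_def w1_def w2_def)
    moreover have "W s = matrix_exp ((lam t - lam s) *\<^sub>R A_mat) *v Z s"
      using Z st by (simp add: W_def w1_def w2_def matrix_exp_A_mat_vec)
    ultimately show ?thesis unfolding \<phi>_def by (simp add: algebra_simps)
  qed
  show ?thesis
    unfolding reflected_solution_pair_def
  proof (intro conjI ballI impI)
    show "Z t \<bullet> e1 \<ge> 0" if "t \<in> {0..1}" for t
      using x Z that by (simp add: e1_def inner_axis)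
  qed (fact mono(2) cadlag_on_continuous[OF cont(3)] carried eqn | simp add: is_interval_cc)+
qed

section \<open>Gluing cycles that accumulate at time 0\<close>

text \<open>The bound on the increments is additive, so every variation sum is at most a telescoping
  one, \<open>h b - h a\<close>.\<close>

lemma C_pvar_if_control:
  assumes "continuous_on {a..b} f"
    and ctrl: "\<And>s t. a \<le> s \<Longrightarrow> s \<le> t \<Longrightarrow> t \<le> b \<Longrightarrow> \<bar>f t - f s\<bar> powr p \<le> h t - h s"
  shows "f \<in> C_pvar p a b"
  unfolding C_pvar_def
proof (intro CollectI conjI bdd_aboveI assms(1))
  fix v assume "v \<in> p_variation_sums p a b f"
  then obtain n \<tau> where v: "v = (\<Sum>i<n. \<bar>f (\<tau> (Suc i)) - f (\<tau> i)\<bar> powr p)"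
    and \<tau>: "\<tau> 0 = a" "\<tau> n = b" "strict_mono_on {..n} \<tau>"
    by (auto simp: p_variation_sums_def)
  have mono: "\<tau> i \<le> \<tau> j" if "i \<le> j" "j \<le> n" for i j
    using strict_mono_on_leD[OF \<tau>(3), of i j] that by auto
  have "v \<le> (\<Sum>i<n. h (\<tau> (Suc i)) - h (\<tau> i))"
    unfolding v
  proof (rule sum_mono)
    fix i assume "i \<in> {..<n}"
    then show "\<bar>f (\<tau> (Suc i)) - f (\<tau> i)\<bar> powr p \<le> h (\<tau> (Suc i)) - h (\<tau> i)"
      using mono[of 0 i] mono[of i "Suc i"] mono[of "Suc i" n] \<tau> by (intro ctrl) auto
  qed
  also have "\<dots> = h b - h a" using sum_lessThan_telescope[of "\<lambda>i. h (\<tau> i)" n] \<tau> by simp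
  finally show "v \<le> h b - h a" .
qed

text \<open>\<open>F n\<close> on \<open>[0,1]\<close> is transported to \<open>[1/(n+2), 1/(n+1)]\<close> by \<open>t = 1/(n+2-s)\<close>.\<close>

definition glue :: "(nat \<Rightarrow> real \<Rightarrow> real) \<Rightarrow> real \<Rightarrow> real" where
  "glue F t = (if t \<le> 0 then 0 else F (nat \<lfloor>1 / t\<rfloor> - 1) (1 - frac (1 / t)))"

abbreviation cell :: "nat \<Rightarrow> real set" where
  "cell n \<equiv> {1 / (real n + 2)..1 / (real n + 1)}"

section \<open>Cells, and functions glued along them\<close>

lemma cellD:
  assumes "t \<in> cell n"
  shows "0 < t" "t \<le> 1" "real n + 2 - 1 / t \<in> {0..1}"
proof -
  have "0 < 1 / (real n + 2)" by simp
  then show pos: "0 < t" using assms by (simp only: atLeastAtMost_iff) linarith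
  have "1 / (real n + 1) \<le> 1" by simp
  then show "t \<le> 1" using assms by (simp only: atLeastAtMost_iff) linarith
  show "real n + 2 - 1 / t \<in> {0..1}"
    using assms pos by (auto simp: field_simps)
qed

lemma cell_exists:
  assumes "0 < t" "t \<le> 1"
  obtains n where "t \<in> cell n"
proof
  define n where "n = nat \<lfloor>1 / t\<rfloor> - 1"
  have "1 \<le> 1 / t" using assms by simp
  then have "1 \<le> \<lfloor>1 / t\<rfloor>" by (simp add: le_floor_iff)
  then have "int n + 1 = \<lfloor>1 / t\<rfloor>" unfolding n_def by arith
  then have "real n + 1 = of_int \<lfloor>1 / t\<rfloor>" by (metis of_int_1 of_int_add of_int_of_nat_eq)
  then have "real n + 1 \<le> 1 / t" "1 / t < real n + 2"
    using floor_correct[of "1 / t"] by linarith+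
  then show "t \<in> cell n" using assms by (auto simp: field_simps)
qed

text \<open>Cell \<open>Suc n\<close> lies to the left of cell \<open>n\<close>;
  \<open>match\<close> makes the two pieces agree at their common end point 1/(n+2).\<close>

locale gluing =
  fixes F :: "nat \<Rightarrow> real \<Rightarrow> real"
  assumes match: "F (Suc n) 1 = F n 0"
begin

lemma glue_cell:
  assumes "t \<in> cell n"
  shows "glue F t = F n (real n + 2 - 1 / t)"
proof -
  have pos: "0 < t" by (rule cellD[OF assms])
  have le: "real n + 1 \<le> 1 / t" "1 / t \<le> real n + 2"
    using assms pos by (auto simp: field_simps)
  show ?thesis
  proof (cases "1 / t = real n + 2")
    \<comment> \<open>At the left end point \<open>glue\<close> selects the piece of index
      \<open>Suc n\<close>.\<close>
    case True
    then have "1 / t = of_nat (n + 2)" by simp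
    then have "\<lfloor>1 / t\<rfloor> = int (n + 2)" by (simp only: floor_of_nat)
    then have "glue F t = F (Suc n) 1" using pos True by (simp add: glue_def frac_def nat_add_distrib)
    then show ?thesis using True match[of n] by simp
  next
    case False
    then have "\<lfloor>1 / t\<rfloor> = int n + 1" using le by (simp add: floor_eq_iff)
    then show ?thesis using pos by (simp add: glue_def frac_def nat_add_distrib algebra_simps)
  qed
qed

lemma glue_node: "glue F (1 / (real n + 1)) = F n 1"
  by (subst glue_cell[of _ n]) (auto simp: field_simps)

lemma glue_has_real_derivative:
  assumes t: "1 / (real n + 2) < t" "t < 1 / (real n + 1)"
    and "(F n has_real_derivative D) (at (real n + 2 - 1 / t))"
  shows "(glue F has_real_derivative D * (1 / t\<^sup>2)) (at t)"
proof -
  have "t > 0" using t cellD(1)[of t n] by auto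
  then have "((\<lambda>u. real n + 2 - 1 / u) has_real_derivative 1 / t\<^sup>2) (at t)"
    by (auto intro!: derivative_eq_intros simp: power2_eq_square)
  from DERIV_chain2[OF assms(3) this]
  show ?thesis
    by (rule has_field_derivative_transform_within_open[of _ _ _ "{1 / (real n + 2)<..<1 / (real n + 1)}"])
      (use t in \<open>auto simp: glue_cell[of _ n]\<close>)
qed

text \<open>Away from 0 only finitely many cells matter. Near 0 the index of the cell is large, so
  the values are close to \<open>glue F 0 = 0\<close>.\<close>

lemma continuous_on_glue:
  assumes cont: "\<And>n. continuous_on {0..1} (F n)"
    and bound: "\<And>n s. s \<in> {0..1} \<Longrightarrow> \<bar>F n s\<bar> \<le> b n" and "b \<longlonglongrightarrow> 0"
  shows "continuous_on {0..1} (glue F)"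
proof -
  have cell: "continuous_on (cell n) (glue F)" for n
  proof -
    have "continuous_on (cell n) (\<lambda>t. F n (real n + 2 - 1 / t))"
      by (rule continuous_on_compose2[OF cont[of n]]) (use cellD in \<open>fastforce intro!: continuous_intros\<close>)+
    then show ?thesis by (rule continuous_on_eq) (simp add: glue_cell)
  qed
  have away: "continuous_on {1 / (real n + 1)..1} (glue F)" for n
  proof (induction n)
    case (Suc n)
    have le: "1 / (real n + 2) \<le> 1 / (real n + 1)" "1 / (real n + 1) \<le> 1" by (simp_all add: frac_le)
    have "{1 / (real (Suc n) + 1)..1} = cell n \<union> {1 / (real n + 1)..1}"
      using le by (subst ivl_disj_un_two_touch(4)) (auto simp: add.commute)
    then show ?case using continuous_on_closed_Un[OF _ _ cell Suc.IH] by simp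
  qed auto
  show ?thesis
    unfolding continuous_on_eq_continuous_within
  proof
    fix t :: real assume t: "t \<in> {0..1}"
    show "continuous (at t within {0..1}) (glue F)"
    proof (cases "t = 0")
      case True
      have "\<exists>d>0. \<forall>u\<in>{0..1}. dist u 0 < d \<longrightarrow> dist (glue F u) (glue F 0) < e" if "e > 0" for e
      proof -
        obtain N where N: "\<And>n. n \<ge> N \<Longrightarrow> b n < e"
          using order_tendstoD(2)[OF \<open>b \<longlonglongrightarrow> 0\<close> \<open>e > 0\<close>] by (auto simp: eventually_sequentially)
        have "dist (glue F u) (glue F 0) < e" if u: "u \<in> {0..1}" "dist u 0 < 1 / (real N + 2)" for u
        proof (cases "u = 0")
          case False
          then obtain n where n: "u \<in> cell n" using u cell_exists[of u] by auto
          then have "1 / (real n + 2) < 1 / (real N + 2)" using u by auto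
          then have "N \<le> n" by (simp add: field_simps)
          then have "\<bar>glue F u\<bar> < e"
            using bound[OF cellD(3)[OF n], of n] N[of n] glue_cell[OF n] by simp
          then show ?thesis by (simp add: glue_def[of F 0])
        qed (use \<open>e > 0\<close> in auto)
        then show ?thesis by (intro exI[of _ "1 / (real N + 2)"]) auto
      qed
      then show ?thesis unfolding True continuous_within_eps_delta by blast
    next
      case False
      then have "t > 0" using t by auto
      obtain n where n: "inverse (real (Suc n)) < t"
        using reals_Archimedean[OF \<open>t > 0\<close>] by auto
      have "continuous (at t within {1 / (real n + 1)..1}) (glue F)"
        using away[of n] n t by (auto simp: continuous_on_eq_continuous_within inverse_eq_divide add.commute)
      also have "at t within {1 / (real n + 1)..1} = at t within {0..1}"
      proof (rule at_within_nhd[of _ "{1 / (real n + 1)<..}"])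
        have "0 < 1 / (real n + 1)" by simp
        then show "{1 / (real n + 1)..1} \<inter> {1 / (real n + 1)<..} - {t} = {0..1} \<inter> {1 / (real n + 1)<..} - {t}"
          by (intro set_eqI) (simp only: Int_iff Diff_iff atLeastAtMost_iff greaterThan_iff, linarith)
      qed (use n in \<open>auto simp: inverse_eq_divide add.commute\<close>)
      finally show ?thesis .
    qed
  qed
qed

text \<open>Neighbouring cells are compared through their common node, by induction. As
  \<open>glue F 0\<close> is 0, comparison with time 0 rests on \<open>nonneg\<close>.\<close>

lemma mono_on_glue:
  assumes mono: "\<And>n. mono_on {0..1} (F n)" and nonneg: "\<And>n. 0 \<le> F n 0"
  shows "mono_on {0..1} (glue F)"
proof -
  have cell: "glue F s \<le> glue F t" if "s \<in> cell n" "t \<in> cell n" "s \<le> t" for s t n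
    unfolding glue_cell[OF that(1)] glue_cell[OF that(2)]
    using that cellD[OF that(1)] cellD[OF that(2)]
    by (intro mono_onD[OF mono]) (auto intro!: divide_left_mono)
  have away: "glue F s \<le> glue F t" if "1 / (real n + 1) \<le> s" "s \<le> t" "t \<le> 1" for s t n
    using that
  proof (induction n arbitrary: s t)
    case 0
    then have "s = t" by simp
    then show ?case by simp
  next
    case (Suc n)
    let ?m = "1 / (real n + 1)"
    have m: "?m \<le> 1" "1 / (real n + 2) \<le> ?m" by (simp_all add: frac_le)
    consider "?m \<le> s" | "s \<le> ?m" "?m \<le> t" | "t \<le> ?m" by linarith
    then show ?case
    proof cases
      case 1
      then show ?thesis using Suc by auto
    next
      case 2
      then have "glue F s \<le> glue F ?m" using Suc.prems m by (intro cell[of _ n]) (auto simp: add.commute)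
      also have "\<dots> \<le> glue F t" using 2 Suc by auto
      finally show ?thesis .
    next
      case 3
      then show ?thesis using Suc.prems by (intro cell[of _ n]) (auto simp: add.commute)
    qed
  qed
  show ?thesis
  proof (rule mono_onI)
    fix s t :: real assume h: "s \<in> {0..1}" "t \<in> {0..1}" "s \<le> t"
    show "glue F s \<le> glue F t"
    proof (cases "s = 0")
      case True
      show ?thesis
      proof (cases "t = 0")
        case False
        then obtain n where n: "t \<in> cell n" using h cell_exists[of t] by auto
        have "0 \<le> F n 0" by (rule nonneg)
        also have "\<dots> \<le> glue F t"
          unfolding glue_cell[OF n] using cellD(3)[OF n] by (intro mono_onD[OF mono]) auto
        finally show ?thesis using True by (simp add: glue_def[of F 0])
      qed (use True in auto)
    next
      case False
      then obtain n where "s \<in> cell n" using h cell_exists[of s] by auto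
      then show ?thesis using h away[of "Suc n" s t] by (auto simp: add.commute)
    qed
  qed
qed

end

text \<open>Cells of larger index come earlier in time. If \<open>B n\<close> is the growth over
  cycle \<open>n\<close>, the tail sum is what has accumulated from time 0 until cycle
  \<open>n\<close> starts.\<close>

definition stack :: "(nat \<Rightarrow> real \<Rightarrow> real) \<Rightarrow> nat \<Rightarrow> real \<Rightarrow> real" where
  "stack B n s = (\<Sum>k. B (k + Suc n) 1) + B n s"

locale stacking =
  fixes B :: "nat \<Rightarrow> real \<Rightarrow> real"
  assumes zero: "B n 0 = 0"
    and mono: "mono_on {0..1} (B n)"
    and cont: "continuous_on {0..1} (B n)"
    and summable: "summable (\<lambda>n. B n 1)"
begin

lemma nonneg: "s \<in> {0..1} \<Longrightarrow> 0 \<le> B n s"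
  using mono_onD[OF mono[of n], of 0 s] zero[of n] by simp

lemma tail_split: "(\<Sum>k. B (k + n) 1) = (\<Sum>k. B (k + Suc n) 1) + B n 1"
  using suminf_split_head[of "\<lambda>k. B (k + n) 1"] summable_ignore_initial_segment[OF summable, of n] by simp

lemma tail_nonneg: "0 \<le> (\<Sum>k. B (k + n) 1)"
  using nonneg summable by (intro suminf_nonneg summable_ignore_initial_segment) auto

sublocale gluing "stack B"
proof
  show "stack B (Suc n) 1 = stack B n 0" for n
    using tail_split[of "Suc n"] by (simp add: stack_def zero)
qed

text \<open>On cell \<open>n\<close> the values are at most the tail sum from \<open>n\<close> on,
  which tends to 0.\<close>

lemma continuous_on_glue_stack: "continuous_on {0..1} (glue (stack B))"
proof (rule continuous_on_glue)
  show "continuous_on {0..1} (stack B n)" for n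
    unfolding stack_def by (intro continuous_intros cont)
  show "\<bar>stack B n s\<bar> \<le> (\<Sum>k. B (k + n) 1)" if "s \<in> {0..1}" for n s
    using nonneg[OF that, of n] mono_onD[OF mono[of n] that, of 1] that tail_nonneg[of "Suc n"]
    by (simp add: stack_def tail_split[of n])
  have "(\<lambda>n. (\<Sum>k. B k 1) - (\<Sum>k<n. B k 1)) \<longlonglongrightarrow> (\<Sum>k. B k 1) - (\<Sum>k. B k 1)"
    by (intro tendsto_intros summable_LIMSEQ summable)
  then show "(\<lambda>n. \<Sum>k. B (k + n) 1) \<longlonglongrightarrow> 0"
    by (simp add: suminf_minus_initial_segment[OF summable])
qed

lemma mono_on_glue_stack: "mono_on {0..1} (glue (stack B))"
proof (rule mono_on_glue)
  show "mono_on {0..1} (stack B n)" for n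
    using mono[of n] by (auto simp: stack_def monotone_on_def)
  show "0 \<le> stack B n 0" for n
    using tail_nonneg[of "Suc n"] by (simp add: stack_def zero)
qed

lemma glue_stack_has_real_derivative:
  assumes "1 / (real n + 2) < t" "t < 1 / (real n + 1)"
    and "(B n has_real_derivative D) (at (real n + 2 - 1 / t))"
  shows "(glue (stack B) has_real_derivative D * (1 / t\<^sup>2)) (at t)"
  using assms by (intro glue_has_real_derivative) (auto simp: stack_def[abs_def] intro!: derivative_eq_intros)

end

section \<open>A single cycle\<close>

definition ramp :: "real \<Rightarrow> real" where
  "ramp u = max 0 (min 1 u)"

lemma ramp_bounds: "0 \<le> ramp u" "ramp u \<le> 1"
  by (auto simp: ramp_def)

lemma ramp_mono: "u \<le> v \<Longrightarrow> ramp u \<le> ramp v"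
  by (auto simp: ramp_def)

lemma ramp_eq [simp]: "u \<le> 0 \<Longrightarrow> ramp u = 0" "1 \<le> u \<Longrightarrow> ramp u = 1"
  by (auto simp: ramp_def)

lemma ramp_eq_self: "0 \<le> u \<Longrightarrow> u \<le> 1 \<Longrightarrow> ramp u = u"
  by (auto simp: ramp_def)

lemma continuous_on_ramp [continuous_intros]:
  "continuous_on S f \<Longrightarrow> continuous_on S (\<lambda>u. ramp (f u))"
  unfolding ramp_def by (intro continuous_intros)

text \<open>Over \<open>s \<in> [0,1]\<close>, \<open>lam\<close> climbs from \<open>0\<close> to \<open>\<delta>\<close> on the first third, \<open>\<gamma>\<close> climbs by \<open>\<epsilon>\<close> on the second
  one, and \<open>lam\<close> returns to \<open>0\<close> on the last one. The positive part of \<open>free_cycle\<close> is \<open>x\<close>, its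
  negative part is what \<open>K\<close> has to compensate on the second third.\<close>

definition lam_cycle :: "real \<Rightarrow> real \<Rightarrow> real" where
  "lam_cycle \<delta> s = \<delta> * (ramp (3 * s) - ramp (3 * s - 2))"

definition gam_cycle :: "real \<Rightarrow> real \<Rightarrow> real" where
  "gam_cycle \<epsilon> s = \<epsilon> * ramp (3 * s - 1)"

text \<open>Only the climb of \<open>lam\<close> enters: after it \<open>lam\<close> rests, and when
  \<open>lam\<close> falls \<open>x\<close> is 0 if the push was strong enough.\<close>

definition y_cycle :: "real \<Rightarrow> real \<Rightarrow> real \<Rightarrow> real" where
  "y_cycle \<delta> \<eta> s = \<eta> * cosh (\<delta> * ramp (3 * s))"

definition free_cycle :: "real \<Rightarrow> real \<Rightarrow> real \<Rightarrow> real \<Rightarrow> real" where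
  "free_cycle \<delta> \<epsilon> \<eta> s = \<eta> * sinh (\<delta> * ramp (3 * s)) - gam_cycle \<epsilon> s"

definition x_cycle :: "real \<Rightarrow> real \<Rightarrow> real \<Rightarrow> real \<Rightarrow> real" where
  "x_cycle \<delta> \<epsilon> \<eta> s = max 0 (free_cycle \<delta> \<epsilon> \<eta> s)"

text \<open>The last term cancels the drift y dlam on the last third, where \<open>y\<close> is
  \<open>\<eta> * cosh \<delta>\<close> and \<open>lam\<close> falls by
  \<open>\<delta>\<close>.\<close>

definition K_cycle :: "real \<Rightarrow> real \<Rightarrow> real \<Rightarrow> real \<Rightarrow> real" where
  "K_cycle \<delta> \<epsilon> \<eta> s = max 0 (- free_cycle \<delta> \<epsilon> \<eta> s) + \<eta> * cosh \<delta> * \<delta> * ramp (3 * s - 2)"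

lemmas cycle_defs = lam_cycle_def gam_cycle_def y_cycle_def x_cycle_def K_cycle_def free_cycle_def

lemma continuous_on_cycle:
  "continuous_on T (lam_cycle \<delta>)" "continuous_on T (gam_cycle \<epsilon>)" "continuous_on T (y_cycle \<delta> \<eta>)"
  "continuous_on T (x_cycle \<delta> \<epsilon> \<eta>)" "continuous_on T (K_cycle \<delta> \<epsilon> \<eta>)"
  unfolding cycle_defs by (intro continuous_intros)+

lemma has_real_derivative_eq_on:
  assumes "(g has_real_derivative D') (at s)" "a < s" "s < b"
    and "\<And>u. a < u \<Longrightarrow> u < b \<Longrightarrow> g u = f u" and "D' = D"
  shows "(f has_real_derivative D) (at s)"
  using assms(2-4)
  by (intro has_field_derivative_transform_within_open[OF assms(1)[unfolded assms(5)], of "{a<..<b}"]) auto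

text \<open>Explicit formulas on four intervals: \<open>(x, y)\<close> moves along a hyperbola,
  \<open>x\<close> is pushed down to 0, stays there against further pushing, and stays there while
  \<open>lam\<close> falls. The excluded points separate these phases.\<close>

lemma cycle_system:
  assumes \<delta>: "0 < \<delta>" and \<epsilon>: "0 < \<epsilon>" and \<eta>: "0 < \<eta>" and push: "\<eta> * sinh \<delta> < \<epsilon>"
    and s: "s \<in> {0<..<1} - {1 / 3, 2 / 3, (\<eta> * sinh \<delta> / \<epsilon> + 1) / 3}"
  shows "\<exists>l g k. (lam_cycle \<delta> has_real_derivative l) (at s) \<and> (gam_cycle \<epsilon> has_real_derivative g) (at s) \<and>
      (K_cycle \<delta> \<epsilon> \<eta> has_real_derivative k) (at s) \<and>
      (x_cycle \<delta> \<epsilon> \<eta> has_real_derivative (y_cycle \<delta> \<eta> s * l + k - g)) (at s) \<and>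
      (y_cycle \<delta> \<eta> has_real_derivative (x_cycle \<delta> \<epsilon> \<eta> s * l)) (at s) \<and> k * x_cycle \<delta> \<epsilon> \<eta> s = 0"
proof -
  \<comment> \<open>The time at which the push has brought \<open>x\<close> from its peak back to 0;
    the strict inequality \<open>push\<close> places it before 2/3.\<close>
  define \<sigma> where "\<sigma> = (\<eta> * sinh \<delta> / \<epsilon> + 1) / 3"
  have \<sigma>: "1 / 3 < \<sigma>" "\<sigma> < 2 / 3"
    using \<delta> \<epsilon> \<eta> push by (auto simp: \<sigma>_def field_simps)
  have \<sigma>_eq: "\<eta> * sinh \<delta> = \<epsilon> * (3 * \<sigma> - 1)"
    using \<epsilon> by (simp add: \<sigma>_def field_simps)
  consider "0 < s" "s < 1 / 3" | "1 / 3 < s" "s < \<sigma>" | "\<sigma> < s" "s < 2 / 3" | "2 / 3 < s" "s < 1"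
    using s unfolding \<sigma>_def by fastforce
  then show ?thesis
  proof cases
    case 1
    have free: "free_cycle \<delta> \<epsilon> \<eta> u = \<eta> * sinh (\<delta> * (3 * u))" "free_cycle \<delta> \<epsilon> \<eta> u > 0" if "0 < u" "u < 1 / 3" for u
      using that \<delta> \<eta> by (simp_all add: cycle_defs ramp_eq_self)
    have x: "x_cycle \<delta> \<epsilon> \<eta> u = \<eta> * sinh (\<delta> * (3 * u))" and K: "K_cycle \<delta> \<epsilon> \<eta> u = 0" if "0 < u" "u < 1 / 3" for u
      using free[OF that] that by (simp_all add: x_cycle_def K_cycle_def)
    note on = has_real_derivative_eq_on[OF _ 1]
    have "(lam_cycle \<delta> has_real_derivative 3 * \<delta>) (at s)"
      by (rule on[of "\<lambda>u. \<delta> * (3 * u)"]) (auto simp: cycle_defs ramp_eq_self intro!: derivative_eq_intros)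
    moreover have "(gam_cycle \<epsilon> has_real_derivative 0) (at s)"
      by (rule on[of "\<lambda>u. 0"]) (auto simp: cycle_defs ramp_eq_self)
    moreover have "(K_cycle \<delta> \<epsilon> \<eta> has_real_derivative 0) (at s)"
      by (rule on[of "\<lambda>u. 0"]) (auto simp: K)
    moreover have "(x_cycle \<delta> \<epsilon> \<eta> has_real_derivative (y_cycle \<delta> \<eta> s * (3 * \<delta>) + 0 - 0)) (at s)"
      by (rule on[of "\<lambda>u. \<eta> * sinh (\<delta> * (3 * u))"])
        (use 1 in \<open>auto simp: x y_cycle_def ramp_eq_self intro!: derivative_eq_intros\<close>)
    moreover have "(y_cycle \<delta> \<eta> has_real_derivative (x_cycle \<delta> \<epsilon> \<eta> s * (3 * \<delta>))) (at s)"
      by (rule on[of "\<lambda>u. \<eta> * cosh (\<delta> * (3 * u))"])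
        (use 1 in \<open>auto simp: x y_cycle_def ramp_eq_self intro!: derivative_eq_intros\<close>)
    ultimately show ?thesis by (intro exI[of _ "3 * \<delta>"] exI[of _ 0]) auto
  next
    case 2
    have free: "free_cycle \<delta> \<epsilon> \<eta> u = \<epsilon> * (3 * \<sigma> - 3 * u)" "free_cycle \<delta> \<epsilon> \<eta> u > 0" if "1 / 3 < u" "u < \<sigma>" for u
      using that \<epsilon> \<sigma> by (simp_all add: cycle_defs ramp_eq_self \<sigma>_eq algebra_simps)
    have x: "x_cycle \<delta> \<epsilon> \<eta> u = \<epsilon> * (3 * \<sigma> - 3 * u)" and K: "K_cycle \<delta> \<epsilon> \<eta> u = 0" if "1 / 3 < u" "u < \<sigma>" for u
      using free[OF that] that \<sigma> by (simp_all add: x_cycle_def K_cycle_def)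
    note on = has_real_derivative_eq_on[OF _ 2]
    have "(lam_cycle \<delta> has_real_derivative 0) (at s)"
      by (rule on[of "\<lambda>u. \<delta>"]) (use \<sigma> in \<open>auto simp: cycle_defs\<close>)
    moreover have "(gam_cycle \<epsilon> has_real_derivative 3 * \<epsilon>) (at s)"
      by (rule on[of "\<lambda>u. \<epsilon> * (3 * u - 1)"])
        (use \<sigma> in \<open>auto simp: cycle_defs ramp_eq_self intro!: derivative_eq_intros\<close>)
    moreover have "(K_cycle \<delta> \<epsilon> \<eta> has_real_derivative 0) (at s)"
      by (rule on[of "\<lambda>u. 0"]) (auto simp: K)
    moreover have "(x_cycle \<delta> \<epsilon> \<eta> has_real_derivative (y_cycle \<delta> \<eta> s * 0 + 0 - 3 * \<epsilon>)) (at s)"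
      by (rule on[of "\<lambda>u. \<epsilon> * (3 * \<sigma> - 3 * u)"])
        (auto simp: x intro!: derivative_eq_intros)
    moreover have "(y_cycle \<delta> \<eta> has_real_derivative (x_cycle \<delta> \<epsilon> \<eta> s * 0)) (at s)"
      by (rule on[of "\<lambda>u. \<eta> * cosh \<delta>"]) (auto simp: y_cycle_def)
    ultimately show ?thesis by (intro exI[of _ 0] exI[of _ "3 * \<epsilon>"]) auto
  next
    \<comment> \<open>With \<open>x\<close> at 0, \<open>K\<close> rises exactly as fast as the
      push.\<close>
    case 3
    have free: "free_cycle \<delta> \<epsilon> \<eta> u = \<epsilon> * (3 * \<sigma> - 3 * u)" "free_cycle \<delta> \<epsilon> \<eta> u < 0" if "\<sigma> < u" "u < 2 / 3" for u
      using that \<epsilon> \<sigma> by (simp_all add: cycle_defs ramp_eq_self \<sigma>_eq algebra_simps)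
    have x0: "x_cycle \<delta> \<epsilon> \<eta> u = 0" and K: "K_cycle \<delta> \<epsilon> \<eta> u = - (\<epsilon> * (3 * \<sigma> - 3 * u))" if "\<sigma> < u" "u < 2 / 3" for u
      using free[OF that] that by (simp_all add: x_cycle_def K_cycle_def)
    note on = has_real_derivative_eq_on[OF _ 3]
    have "(lam_cycle \<delta> has_real_derivative 0) (at s)"
      by (rule on[of "\<lambda>u. \<delta>"]) (use \<sigma> in \<open>auto simp: cycle_defs\<close>)
    moreover have "(gam_cycle \<epsilon> has_real_derivative 3 * \<epsilon>) (at s)"
      by (rule on[of "\<lambda>u. \<epsilon> * (3 * u - 1)"])
        (use \<sigma> in \<open>auto simp: cycle_defs ramp_eq_self intro!: derivative_eq_intros\<close>)
    moreover have "(K_cycle \<delta> \<epsilon> \<eta> has_real_derivative 3 * \<epsilon>) (at s)"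
      by (rule on[of "\<lambda>u. - (\<epsilon> * (3 * \<sigma> - 3 * u))"])
        (auto simp: K intro!: derivative_eq_intros)
    moreover have "(x_cycle \<delta> \<epsilon> \<eta> has_real_derivative (y_cycle \<delta> \<eta> s * 0 + 3 * \<epsilon> - 3 * \<epsilon>)) (at s)"
      by (rule on[of "\<lambda>u. 0"]) (auto simp: x0)
    moreover have "(y_cycle \<delta> \<eta> has_real_derivative (x_cycle \<delta> \<epsilon> \<eta> s * 0)) (at s)"
      by (rule on[of "\<lambda>u. \<eta> * cosh \<delta>"]) (use \<sigma> in \<open>auto simp: y_cycle_def\<close>)
    ultimately show ?thesis using x0[OF 3] by (intro exI[of _ 0] exI[of _ "3 * \<epsilon>"]) auto
  next
    \<comment> \<open>The fall of \<open>lam\<close> would drive \<open>x\<close> below 0 at rate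
      \<open>3 * \<delta>\<close> times \<open>y\<close>; \<open>K\<close> offsets this, and
      \<open>y\<close> is constant because \<open>x\<close> is 0.\<close>
    case 4
    have free: "free_cycle \<delta> \<epsilon> \<eta> u = \<eta> * sinh \<delta> - \<epsilon>" "free_cycle \<delta> \<epsilon> \<eta> u < 0" if "2 / 3 < u" "u < 1" for u
      using that push by (simp_all add: cycle_defs)
    have x0: "x_cycle \<delta> \<epsilon> \<eta> u = 0" if "2 / 3 < u" "u < 1" for u
      using free(2)[OF that] by (simp add: x_cycle_def)
    let ?k = "3 * (\<eta> * cosh \<delta> * \<delta>)"
    note on = has_real_derivative_eq_on[OF _ 4]
    have "(lam_cycle \<delta> has_real_derivative - 3 * \<delta>) (at s)"
      by (rule on[of "\<lambda>u. \<delta> * (3 - 3 * u)"]) (auto simp: cycle_defs ramp_eq_self intro!: derivative_eq_intros)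
    moreover have "(gam_cycle \<epsilon> has_real_derivative 0) (at s)"
      by (rule on[of "\<lambda>u. \<epsilon>"]) (auto simp: cycle_defs)
    moreover have "(K_cycle \<delta> \<epsilon> \<eta> has_real_derivative ?k) (at s)"
      by (rule on[of "\<lambda>u. (\<epsilon> - \<eta> * sinh \<delta>) + \<eta> * cosh \<delta> * \<delta> * (3 * u - 2)"])
        (use free push in \<open>auto simp: K_cycle_def ramp_eq_self intro!: derivative_eq_intros\<close>)
    moreover have "(x_cycle \<delta> \<epsilon> \<eta> has_real_derivative (y_cycle \<delta> \<eta> s * (- 3 * \<delta>) + ?k - 0)) (at s)"
      by (rule on[of "\<lambda>u. 0"]) (use 4 in \<open>auto simp: x0 y_cycle_def\<close>)
    moreover have "(y_cycle \<delta> \<eta> has_real_derivative (x_cycle \<delta> \<epsilon> \<eta> s * (- 3 * \<delta>))) (at s)"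
      by (rule on[of "\<lambda>u. \<eta> * cosh \<delta>"]) (use 4 in \<open>auto simp: x0 y_cycle_def\<close>)
    ultimately show ?thesis using x0[OF 4] by (intro exI[of _ "- 3 * \<delta>"] exI[of _ 0] exI[of _ ?k]) auto
  qed
qed

text \<open>Up to time 1/3 the push has not begun and \<open>free_cycle\<close> is nonnegative;
  afterwards the sinh term is constant, so \<open>- free_cycle\<close> grows with the push.\<close>

lemma mono_on_K_cycle:
  assumes "0 \<le> \<delta>" "0 \<le> \<epsilon>" "0 \<le> \<eta>"
  shows "mono_on {0..1} (K_cycle \<delta> \<epsilon> \<eta>)"
proof (rule mono_onI)
  fix s t :: real assume st: "s \<in> {0..1}" "t \<in> {0..1}" "s \<le> t"
  have "max 0 (- free_cycle \<delta> \<epsilon> \<eta> s) \<le> max 0 (- free_cycle \<delta> \<epsilon> \<eta> t)"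
  proof (cases "s \<le> 1 / 3")
    case True
    then have "0 \<le> free_cycle \<delta> \<epsilon> \<eta> s"
      using assms ramp_bounds by (simp add: cycle_defs)
    then show ?thesis by auto
  next
    case False
    then have "ramp (3 * s) = 1" "ramp (3 * t) = 1" using st by auto
    then show ?thesis
      using assms st ramp_mono[of "3 * s - 1" "3 * t - 1"]
      by (intro max.mono) (auto simp: cycle_defs intro!: mult_left_mono)
  qed
  moreover have "\<eta> * cosh \<delta> * \<delta> * ramp (3 * s - 2) \<le> \<eta> * cosh \<delta> * \<delta> * ramp (3 * t - 2)"
    using assms st by (intro mult_left_mono ramp_mono) auto
  ultimately show "K_cycle \<delta> \<epsilon> \<eta> s \<le> K_cycle \<delta> \<epsilon> \<eta> t"
    by (simp add: K_cycle_def)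
qed

section \<open>The driving paths and the solutions\<close>

text \<open>Follows from cosh u = 1 + 2 sinh(u/2)^2 and sinh v \<ge> v for v \<ge> 0. It serves to
  bound \<open>height\<close> through its known cosh.\<close>

lemma cosh_ge_1_plus_square:
  fixes u :: real
  shows "1 + u\<^sup>2 / 2 \<le> cosh u"
proof -
  have "(u / 2)\<^sup>2 \<le> (sinh (u / 2))\<^sup>2"
  proof (cases "0 \<le> u")
    case True
    then show ?thesis
      using real_le_x_sinh[of "u / 2"] by (intro power_mono) (auto simp: sinh_field_def exp_minus)
  next
    case False
    then have "(- u / 2)\<^sup>2 \<le> (sinh (- u / 2))\<^sup>2"
      using real_le_x_sinh[of "- u / 2"] by (intro power_mono) (auto simp: sinh_field_def exp_minus)
    then show ?thesis by simp
  qed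
  moreover have "cosh u = 1 + 2 * (sinh (u / 2))\<^sup>2"
    using cosh_double_cosh[of "u / 2"] by (simp add: cosh_square_eq)
  ultimately show ?thesis by (simp add: power_divide)
qed

text \<open>With this height \<open>\<eta> / (n + 2)\<^sup>2\<close> grows to \<open>\<eta> / (n + 1)\<^sup>2\<close> over the cycle number \<open>n\<close>.\<close>

definition height :: "nat \<Rightarrow> real" where
  "height n = arcosh (((real n + 2) / (real n + 1))\<^sup>2)"

text \<open>Large enough for all values \<open>c < 1\<close> at once (see
  \<open>level_sinh\<close>), so that one \<open>\<gamma>\<close> serves all solutions, and still
  summable.\<close>

definition push :: "nat \<Rightarrow> real" where
  "push n = 4 / (real n + 2)\<^sup>2"

lemma cosh_height: "cosh (height n) = ((real n + 2) / (real n + 1))\<^sup>2"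
  unfolding height_def by (rule cosh_arcosh_real) (simp add: one_le_power)

lemma height_pos: "0 < height n"
proof -
  have "1 < ((real n + 2) / (real n + 1))\<^sup>2" by (rule one_less_power) auto
  then show ?thesis unfolding height_def by (metis arcosh_real_gt_1_iff less_imp_le less_irrefl)
qed

text \<open>With h = 1/(n+1) the cosh is (1 + h)^2 \<le> 1 + 3h, and the quadratic lower bound for
  cosh gives the order n^(-1/2).\<close>

lemma height_bound: "height n \<le> sqrt (6 / (real n + 1))"
proof -
  have "1 + (height n)\<^sup>2 / 2 \<le> ((real n + 2) / (real n + 1))\<^sup>2"
    using cosh_ge_1_plus_square[of "height n"] by (simp add: cosh_height)
  also have "(real n + 2) / (real n + 1) = 1 + 1 / (real n + 1)"
    by (simp add: field_simps)
  also have "(1 + 1 / (real n + 1))\<^sup>2 \<le> 1 + 3 / (real n + 1)"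
    using power_decreasing[of 1 2 "1 / (real n + 1)"] by (simp add: power2_sum)
  finally have "(height n)\<^sup>2 \<le> 6 / (real n + 1)" by simp
  then show ?thesis by (rule real_le_rsqrt)
qed

lemma height_tendsto: "height \<longlonglongrightarrow> 0"
proof (rule tendsto_sandwich)
  show "\<forall>\<^sub>F n in sequentially. 0 \<le> height n" using height_pos by (simp add: less_imp_le)
  show "\<forall>\<^sub>F n in sequentially. height n \<le> sqrt (6 / (real n + 1))" using height_bound by simp
  have "(\<lambda>n. sqrt (6 * inverse (real (Suc n)))) \<longlonglongrightarrow> sqrt (6 * 0)"
    by (intro tendsto_intros LIMSEQ_inverse_real_of_nat)
  then show "(\<lambda>n. sqrt (6 / (real n + 1))) \<longlonglongrightarrow> 0"
    by (simp add: divide_inverse add.commute)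
qed auto

text \<open>Comparison with the series of n^(-p/2), which converges because p > 2.\<close>

lemma summable_height_powr:
  assumes "2 < p"
  shows "summable (\<lambda>n. height n powr p)"
proof (rule summable_comparison_test')
  have "summable (\<lambda>n. real n powr (- p / 2))"
    using assms by (subst summable_real_powr_iff) auto
  then have "summable (\<lambda>n. real (n + 1) powr (- p / 2))"
    by (rule summable_ignore_initial_segment)
  then show "summable (\<lambda>n. 6 powr (p / 2) * real (n + 1) powr (- p / 2))"
    by (rule summable_mult)
  fix n
  have "height n powr p \<le> sqrt (6 / (real n + 1)) powr p"
    using assms height_bound[of n] height_pos[of n] by (intro powr_mono2) auto
  also have "\<dots> = (6 / (real n + 1)) powr (p / 2)"
    by (subst powr_half_sqrt[symmetric]) (simp_all add: powr_powr)
  also have "\<dots> = 6 powr (p / 2) * real (n + 1) powr (- p / 2)"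
    by (simp add: powr_divide powr_minus_divide add.commute)
  finally show "norm (height n powr p) \<le> 6 powr (p / 2) * real (n + 1) powr (- p / 2)" by simp
qed

lemma summable_inverse_squares: "summable (\<lambda>n. C / (real n + 1)\<^sup>2)"
proof -
  have "summable (\<lambda>n. inverse (real (Suc n) ^ 2))"
    using inverse_power_summable[of 2, where 'a = real] by (subst summable_Suc_iff) auto
  then have "summable (\<lambda>n. C * inverse (real (Suc n) ^ 2))" by (rule summable_mult)
  then show ?thesis by (simp add: divide_inverse add.commute)
qed

lemma push_bounds: "0 < push n" "push n \<le> 4 / (real n + 1)\<^sup>2"
  unfolding push_def by (auto intro!: divide_left_mono power_mono)

section \<open>The driving path and the push\<close>

definition driver :: "real \<Rightarrow> real" where
  "driver = glue (\<lambda>n. lam_cycle (height n))"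

text \<open>The cycles of \<open>driver\<close> return to 0 and are glued as they are; those of the
  push only grow and have to be stacked.\<close>

definition pusher :: "real \<Rightarrow> real" where
  "pusher = glue (stack (\<lambda>n. gam_cycle (push n)))"

interpretation lam: gluing "\<lambda>n. lam_cycle (height n)"
  by unfold_locales (simp add: lam_cycle_def)

interpretation gam: stacking "\<lambda>n. gam_cycle (push n)"
proof
  show "mono_on {0..1} (gam_cycle (push n))" for n
    using push_bounds(1)[of n] by (auto simp: gam_cycle_def intro!: mono_onI mult_left_mono ramp_mono)
  show "summable (\<lambda>n. gam_cycle (push n) 1)"
  proof (rule summable_comparison_test'[OF summable_inverse_squares[of 4], of 0])
    show "norm (gam_cycle (push n) 1) \<le> 4 / (real n + 1)\<^sup>2" for n
      using push_bounds[of n] by (simp add: gam_cycle_def)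
  qed
qed (auto simp: gam_cycle_def intro!: continuous_on_cycle[unfolded gam_cycle_def])

lemma lam_cycle_bounds:
  assumes "0 \<le> \<delta>"
  shows "0 \<le> lam_cycle \<delta> s" "lam_cycle \<delta> s \<le> \<delta>"
proof -
  have "0 \<le> ramp (3 * s) - ramp (3 * s - 2)" "ramp (3 * s) - ramp (3 * s - 2) \<le> 1"
    using ramp_mono[of "3 * s - 2" "3 * s"] ramp_bounds[of "3 * s"] ramp_bounds[of "3 * s - 2"] by auto
  then show "0 \<le> lam_cycle \<delta> s" "lam_cycle \<delta> s \<le> \<delta>"
    using assms mult_left_mono[of _ 1 \<delta>] by (simp_all add: lam_cycle_def)
qed

lemma driver_nonneg: "0 \<le> driver t"
  using lam_cycle_bounds(1) height_pos by (simp add: driver_def glue_def less_imp_le)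

lemma driver_node: "driver (1 / (real n + 1)) = 0"
  unfolding driver_def lam.glue_node by (simp add: lam_cycle_def)

lemma continuous_on_driver: "continuous_on {0..1} driver"
  unfolding driver_def
  using height_tendsto lam_cycle_bounds height_pos
  by (intro lam.continuous_on_glue[where b = height] continuous_on_cycle) (auto simp: less_imp_le)

lemma driver_C_pvar:
  assumes p: "2 < p"
  shows "driver \<in> C_pvar p 0 1"
proof -
  \<comment> \<open>Since every cycle starts and ends with \<open>driver = 0\<close>, the increments of \<open>driver\<close> are controlled by
    the function that collects \<open>\<delta>\<^sub>n\<^sup>p\<close> on each of the two monotone pieces of the \<open>n\<close>-th cycle.\<close>
  define B where "B = (\<lambda>n s. height n powr p * (ramp (3 * s) + ramp (3 * s - 2)))"
  interpret stacking B
  proof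
    show "mono_on {0..1} (B n)" for n
      by (auto simp: B_def intro!: mono_onI mult_left_mono add_mono ramp_mono)
    show "continuous_on {0..1} (B n)" for n
      unfolding B_def by (intro continuous_intros)
    show "summable (\<lambda>n. B n 1)"
      using summable_mult2[OF summable_height_powr[OF p], of 2] by (simp add: B_def)
  qed (simp add: B_def)
  define h where "h = glue (stack B)"
  have h_mono: "h s \<le> h t" if "0 \<le> s" "s \<le> t" "t \<le> 1" for s t
    using mono_onD[OF mono_on_glue_stack] that by (simp add: h_def)
  have cell: "\<bar>driver t - driver s\<bar> powr p \<le> h t - h s" if st: "s \<in> cell n" "t \<in> cell n" "s \<le> t" for s t n
  proof -
    define s' t' where "s' = real n + 2 - 1 / s" and "t' = real n + 2 - 1 / t"
    have "s' \<le> t'"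
      using st cellD[OF st(1)] by (auto simp: s'_def t'_def intro!: divide_left_mono)
    define D where "D = (ramp (3 * t') - ramp (3 * s')) - (ramp (3 * t' - 2) - ramp (3 * s' - 2))"
    have D: "\<bar>D\<bar> \<le> 1" "\<bar>D\<bar> \<le> (ramp (3 * t') - ramp (3 * s')) + (ramp (3 * t' - 2) - ramp (3 * s' - 2))"
      using ramp_mono[of "3 * s'" "3 * t'"] ramp_mono[of "3 * s' - 2" "3 * t' - 2"] \<open>s' \<le> t'\<close>
        ramp_bounds[of "3 * s'"] ramp_bounds[of "3 * t'"]
        ramp_bounds[of "3 * s' - 2"] ramp_bounds[of "3 * t' - 2"]
      by (auto simp: D_def)
    have "driver t - driver s = height n * D"
      unfolding driver_def lam.glue_cell[OF st(1)] lam.glue_cell[OF st(2)]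
      by (simp add: s'_def t'_def D_def lam_cycle_def right_diff_distrib)
    then have "\<bar>driver t - driver s\<bar> powr p = height n powr p * \<bar>D\<bar> powr p"
      using height_pos[of n] by (simp add: abs_mult powr_mult)
    also have "\<bar>D\<bar> powr p \<le> \<bar>D\<bar>"
      using D(1) p by (cases "D = 0") (auto intro!: powr_le_one_le)
    also note D(2)
    also have "height n powr p * ((ramp (3 * t') - ramp (3 * s')) + (ramp (3 * t' - 2) - ramp (3 * s' - 2)))
        = h t - h s"
      unfolding h_def glue_cell[OF st(1)] glue_cell[OF st(2)]
      by (simp add: stack_def B_def s'_def t'_def algebra_simps)
    finally show ?thesis by (simp add: mult_left_mono)
  qed
  have left: "driver t powr p \<le> h t - h (1 / (real n + 2))" if t: "t \<in> cell n" for t n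
  proof -
    have "1 / (real n + 2) \<in> cell n" by (simp add: frac_le)
    then have "\<bar>driver t - driver (1 / (real n + 2))\<bar> powr p \<le> h t - h (1 / (real n + 2))"
      using t by (intro cell[of _ n]) auto
    moreover have "driver (1 / (real n + 2)) = 0"
      using driver_node[of "Suc n"] by (simp add: add.commute)
    ultimately show ?thesis using driver_nonneg[of t] by simp
  qed
  have right: "driver s powr p \<le> h (1 / (real n + 1)) - h s" if s: "s \<in> cell n" for s n
  proof -
    have "1 / (real n + 1) \<in> cell n" by (simp add: frac_le)
    then have "\<bar>driver (1 / (real n + 1)) - driver s\<bar> powr p \<le> h (1 / (real n + 1)) - h s"
      using s by (intro cell[of _ n]) auto
    then show ?thesis using driver_node[of n] driver_nonneg[of s] by simp
  qed
  show ?thesis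
  proof (rule C_pvar_if_control[OF continuous_on_driver, where h = h])
    fix s t :: real assume st: "0 \<le> s" "s \<le> t" "t \<le> 1"
    show "\<bar>driver t - driver s\<bar> powr p \<le> h t - h s"
    proof (cases "t = 0")
      case False
      then obtain n where n: "t \<in> cell n" using st cell_exists[of t] by auto
      have node: "0 \<le> 1 / (real n + 2)" "1 / (real n + 2) \<le> t" using n by auto
      consider "s = 0" | "s \<in> cell n" | "0 < s" "s < 1 / (real n + 2)"
        using st n by fastforce
      then show ?thesis
      proof cases
        case 1
        have "driver t powr p \<le> h t - h 0"
          using left[OF n] h_mono[of 0 "1 / (real n + 2)"] node st by linarith
        then show ?thesis using 1 driver_nonneg[of t] by (simp add: driver_def glue_def[of _ 0])
      next
        case 2
        then show ?thesis using cell n st by blast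
      next
        \<comment> \<open>Both values are nonnegative, so the increment is at most the larger one.
          Each value is controlled by the growth of \<open>h\<close> between its own time and a node
          in between, where \<open>driver\<close> vanishes.\<close>
        case 3
        obtain m where m: "s \<in> cell m" using 3 st cell_exists[of s] by auto
        have "1 / (real m + 2) < 1 / (real n + 2)" using m 3 by auto
        then have "n < m" by (simp add: field_simps)
        then have mn: "1 / (real m + 1) \<le> 1 / (real n + 2)" by (intro frac_le) auto
        have "driver t powr p \<le> h t - h s"
          using left[OF n] h_mono[of s "1 / (real n + 2)"] node st 3 by linarith
        moreover have "driver s powr p \<le> h t - h s"
          using right[OF m] h_mono[of "1 / (real m + 1)" t] mn node st by simp
        moreover have "\<bar>driver t - driver s\<bar> powr p \<le> max (driver t) (driver s) powr p"
          using driver_nonneg[of s] driver_nonneg[of t] p by (intro powr_mono2) auto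
        ultimately show ?thesis by (auto simp: max_def split: if_splits)
      qed
    qed (use st in simp)
  qed
qed

text \<open>\<open>c\<close> will be the value of \<open>y\<close> at time 1, so different
  \<open>c\<close> give different solutions.\<close>

locale started =
  fixes c :: real
  assumes c: "0 < c" "c < 1"
begin

text \<open>The value of \<open>y\<close> at the start of cycle \<open>n\<close>, obtained from
  \<open>c\<close> at time 1 by going back through the factors
  \<open>cosh (height n)\<close>.\<close>

definition level :: "nat \<Rightarrow> real" where
  "level n = c / (real n + 2)\<^sup>2"

lemma level_pos: "0 < level n"
  using c by (simp add: level_def)

lemma level_cosh: "level n * cosh (height n) = c / (real n + 1)\<^sup>2"
  by (simp add: level_def cosh_height power_divide)

text \<open>The ratio (n+2)/(n+1) is at most 2, so sinh < cosh \<le> 4, which is the constant in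
  \<open>push\<close>; and \<open>c < 1\<close>.\<close>

lemma level_sinh: "level n * sinh (height n) < push n"
proof -
  have "(real n + 2) / (real n + 1) \<le> 2" by (simp add: field_simps)
  then have "((real n + 2) / (real n + 1))\<^sup>2 \<le> 2\<^sup>2" by (rule power_mono) simp
  then have "sinh (height n) < 4"
    using sinh_less_cosh_real[of "height n"] by (simp add: cosh_height)
  then have "level n * sinh (height n) < level n * 4"
    using level_pos by (rule mult_strict_left_mono)
  also have "\<dots> \<le> push n" using c by (simp add: level_def push_def divide_right_mono)
  finally show ?thesis .
qed

definition y where "y = glue (\<lambda>n. y_cycle (height n) (level n))"
definition x where "x = glue (\<lambda>n. x_cycle (height n) (push n) (level n))"
definition K where "K = glue (stack (\<lambda>n. K_cycle (height n) (push n) (level n)))"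

lemma y_cycle_bounds:
  "0 < y_cycle (height n) (level n) s" "y_cycle (height n) (level n) s \<le> c / (real n + 1)\<^sup>2"
proof -
  show "0 < y_cycle (height n) (level n) s"
    using level_pos by (simp add: y_cycle_def)
  have "height n * ramp (3 * s) \<le> height n * 1"
    using height_pos ramp_bounds by (intro mult_left_mono) (auto simp: less_imp_le)
  then have "cosh (height n * ramp (3 * s)) \<le> cosh (height n)"
    using height_pos[of n] ramp_bounds[of "3 * s"] by (subst cosh_real_nonneg_le_iff) auto
  then show "y_cycle (height n) (level n) s \<le> c / (real n + 1)\<^sup>2"
    using level_pos[of n] unfolding y_cycle_def level_cosh[symmetric] by simp
qed

lemma x_cycle_bounds:
  "0 \<le> x_cycle (height n) (push n) (level n) s" "x_cycle (height n) (push n) (level n) s \<le> c / (real n + 1)\<^sup>2"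
proof -
  show "0 \<le> x_cycle (height n) (push n) (level n) s" by (simp add: x_cycle_def)
  have "level n * sinh (height n * ramp (3 * s)) \<le> y_cycle (height n) (level n) s"
    using level_pos[of n] sinh_le_cosh_real by (simp add: y_cycle_def)
  moreover have "0 \<le> gam_cycle (push n) s"
    using push_bounds(1)[of n] ramp_bounds by (simp add: gam_cycle_def)
  ultimately show "x_cycle (height n) (push n) (level n) s \<le> c / (real n + 1)\<^sup>2"
    using y_cycle_bounds[of n s] by (simp add: x_cycle_def free_cycle_def)
qed

sublocale y: gluing "\<lambda>n. y_cycle (height n) (level n)"
  by unfold_locales (simp add: y_cycle_def level_cosh, simp add: level_def add_ac)

text \<open>Every cycle starts with \<open>x\<close> at 0 and, since the push is strong enough, also
  ends there.\<close>

sublocale x: gluing "\<lambda>n. x_cycle (height n) (push n) (level n)"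
  by unfold_locales (use level_sinh[of "Suc _"] in \<open>simp add: x_cycle_def free_cycle_def gam_cycle_def less_imp_le\<close>)

sublocale K: stacking "\<lambda>n. K_cycle (height n) (push n) (level n)"
proof
  show "mono_on {0..1} (K_cycle (height n) (push n) (level n))" for n
    using height_pos[of n] push_bounds(1)[of n] level_pos[of n] by (intro mono_on_K_cycle) auto
  show "continuous_on {0..1} (K_cycle (height n) (push n) (level n))" for n
    by (rule continuous_on_cycle)
  show "K_cycle (height n) (push n) (level n) 0 = 0" for n
    by (simp add: K_cycle_def free_cycle_def gam_cycle_def)
  show "summable (\<lambda>n. K_cycle (height n) (push n) (level n) 1)"
  \<comment> \<open>7 = 4 + 3: the 4 comes from \<open>push\<close>, the 3 from the last third, as
    \<open>height n\<close> is at most 3.\<close>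
  proof (rule summable_comparison_test'[OF summable_inverse_squares[of "7"], of 0])
    fix n
    have "0 \<le> level n * sinh (height n)" using level_pos[of n] height_pos[of n] by simp
    moreover have "height n \<le> 3"
    proof -
      have "sqrt (6 / (real n + 1)) \<le> 3" by (intro real_le_lsqrt) (auto simp: field_simps)
      then show ?thesis using height_bound[of n] by simp
    qed
    then have "c / (real n + 1)\<^sup>2 * height n \<le> 1 / (real n + 1)\<^sup>2 * 3"
      using c height_pos[of n] by (intro mult_mono divide_right_mono) auto
    moreover have "K_cycle (height n) (push n) (level n) 1
        = push n - level n * sinh (height n) + c / (real n + 1)\<^sup>2 * height n"
      using level_sinh[of n] by (simp add: K_cycle_def free_cycle_def gam_cycle_def level_cosh)
    moreover have "0 \<le> c / (real n + 1)\<^sup>2 * height n"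
      using c height_pos[of n] by simp
    moreover have "7 / (real n + 1)\<^sup>2 = 4 / (real n + 1)\<^sup>2 + 1 / (real n + 1)\<^sup>2 * 3"
      by (simp add: add_divide_distrib[symmetric])
    ultimately show "norm (K_cycle (height n) (push n) (level n) 1) \<le> 7 / (real n + 1)\<^sup>2"
      using push_bounds[of n] level_sinh[of n] by simp
  qed
qed

lemma tendsto_bound: "(\<lambda>n. c / (real n + 1)\<^sup>2) \<longlonglongrightarrow> 0"
  by (rule summable_LIMSEQ_zero[OF summable_inverse_squares])

lemma continuous_on_x: "continuous_on {0..1} x"
  unfolding x_def
  by (rule x.continuous_on_glue[OF continuous_on_cycle(4) _ tendsto_bound]) (use x_cycle_bounds in simp)

lemma continuous_on_y: "continuous_on {0..1} y"
  unfolding y_def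
  by (rule y.continuous_on_glue[OF continuous_on_cycle(3) _ tendsto_bound])
    (use y_cycle_bounds in \<open>simp add: less_imp_le\<close>)

lemma x_nonneg: "0 \<le> x t"
  using x_cycle_bounds(1) by (simp add: x_def glue_def)

lemma y_pos: "0 < t \<Longrightarrow> 0 < y t"
  using y_cycle_bounds(1) by (simp add: y_def glue_def)

lemma y_1: "y 1 = c"
  using y.glue_node[of 0] level_cosh[of 0] by (simp add: y_def y_cycle_def)

text \<open>The restriction makes \<open>Z\<close> extensional, so that distinct elements of the
  solution set differ on \<open>[0,1]\<close> itself.\<close>

definition "Z = (\<lambda>t\<in>{0..1}. vector [x t, y t] :: real^2)"

text \<open>The exceptional points of cycle \<open>n\<close> in its own time; 0 and 1 are the ends
  of the cell.\<close>

definition "kinks n = {0, 1 / 3, 2 / 3, 1, (level n * sinh (height n) / push n + 1) / 3}"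

text \<open>On each cell the change of time multiplies all derivatives by the same factor
  \<open>1 / t\<^sup>2\<close>, and the system is linear in them, so \<open>cycle_system\<close>
  carries over.\<close>

lemma solution: "reflected_solution_pair driver pusher {0..1} Z K"
proof (rule reflected_solution_pairI)
  let ?S = "\<Union>n. (\<lambda>s. 1 / (real n + 2 - s)) ` kinks n"
  show "countable ?S" by (auto simp: kinks_def)
  fix t assume t: "t \<in> {0<..<1} - ?S"
  then obtain n where n: "t \<in> cell n" using cell_exists[of t] by auto
  define s where "s = real n + 2 - 1 / t"
  have "t = 1 / (real n + 2 - s)" by (simp add: s_def)
  then have kink: "s \<notin> kinks n" using t by blast
  then have s: "s \<in> {0<..<1} - {1 / 3, 2 / 3, (level n * sinh (height n) / push n + 1) / 3}"
    using cellD(3)[OF n] unfolding s_def[symmetric] by (auto simp: kinks_def less_le)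
  then have tn: "1 / (real n + 2) < t" "t < 1 / (real n + 1)"
    using cellD(1)[OF n] by (auto simp: s_def field_simps)
  have xs: "x_cycle (height n) (push n) (level n) s = x t" and ys: "y_cycle (height n) (level n) s = y t"
    by (simp_all add: x_def y_def x.glue_cell[OF n] y.glue_cell[OF n] s_def)
  obtain l g k where D:
      "(lam_cycle (height n) has_real_derivative l) (at s)"
      "(gam_cycle (push n) has_real_derivative g) (at s)"
      "(K_cycle (height n) (push n) (level n) has_real_derivative k) (at s)"
      "(x_cycle (height n) (push n) (level n) has_real_derivative (y t * l + k - g)) (at s)"
      "(y_cycle (height n) (level n) has_real_derivative (x t * l)) (at s)"
      "k * x t = 0"
    using cycle_system[OF height_pos push_bounds(1) level_pos level_sinh s] unfolding xs ys by blast
  let ?m = "1 / t\<^sup>2"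
  have "(driver has_real_derivative l * ?m) (at t)"
    unfolding driver_def by (rule lam.glue_has_real_derivative[OF tn D(1)[unfolded s_def]])
  moreover have "(pusher has_real_derivative g * ?m) (at t)"
    unfolding pusher_def by (rule gam.glue_stack_has_real_derivative[OF tn D(2)[unfolded s_def]])
  moreover have "(K has_real_derivative k * ?m) (at t)"
    unfolding K_def by (rule K.glue_stack_has_real_derivative[OF tn D(3)[unfolded s_def]])
  moreover have "(x has_real_derivative (y t * (l * ?m) + k * ?m - g * ?m)) (at t)"
    using x.glue_has_real_derivative[OF tn D(4)[unfolded s_def]] by (simp add: x_def[symmetric] algebra_simps add_divide_distrib)
  moreover have "(y has_real_derivative (x t * (l * ?m))) (at t)"
    using y.glue_has_real_derivative[OF tn D(5)[unfolded s_def]] by (simp add: y_def[symmetric] mult.assoc)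
  ultimately show "\<exists>l g k. (driver has_real_derivative l) (at t) \<and> (pusher has_real_derivative g) (at t) \<and>
      (K has_real_derivative k) (at t) \<and> (x has_real_derivative (y t * l + k - g)) (at t) \<and>
      (y has_real_derivative (x t * l)) (at t) \<and> k * x t = 0"
    using D(6) by (intro exI[of _ "l * ?m"] exI[of _ "g * ?m"] exI[of _ "k * ?m"]) auto
next
  show "continuous_on {0..1} pusher" "mono_on {0..1} pusher"
    unfolding pusher_def by (rule gam.continuous_on_glue_stack gam.mono_on_glue_stack)+
  show "continuous_on {0..1} K" "mono_on {0..1} K"
    unfolding K_def by (rule K.continuous_on_glue_stack K.mono_on_glue_stack)+
qed (simp_all add: continuous_on_driver continuous_on_x continuous_on_y x_nonneg Z_def)

end

section \<open>Uncountably many solutions, separated by their values at time 1\<close>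

theorem theorem2p1:
  shows "\<exists>(lam::real \<Rightarrow> real) (\<gamma>::real \<Rightarrow> real).
    lam \<in> (\<Inter>p\<in>{2<..}. C_pvar p 0 1) \<and>
    continuous_on {0..1} \<gamma> \<and> mono_on {0..1} \<gamma> \<and>
    uncountable {Z \<in> {0..1} \<rightarrow>\<^sub>E (UNIV :: (real^2) set).
      reflected_solution lam \<gamma> {0..1} Z \<and> Z 0 = 0 \<and> (\<forall>t\<in>{0<..1}. Z t \<noteq> 0)}"
proof (intro exI conjI)
  show "driver \<in> (\<Inter>p\<in>{2<..}. C_pvar p 0 1)" using driver_C_pvar by auto
  show "continuous_on {0..1} pusher" "mono_on {0..1} pusher"
    unfolding pusher_def by (rule gam.continuous_on_glue_stack gam.mono_on_glue_stack)+
  let ?Sol = "{Z \<in> {0..1} \<rightarrow>\<^sub>E (UNIV :: (real^2) set).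
      reflected_solution driver pusher {0..1} Z \<and> Z 0 = 0 \<and> (\<forall>t\<in>{0<..1}. Z t \<noteq> 0)}"
  have "started.Z c \<in> ?Sol" if "c \<in> {0<..<1}" for c
  proof -
    interpret started c using that by unfold_locales auto
    have "Z 0 = 0" by (simp add: Z_def x_def y_def glue_def vec_eq_iff forall_2)
    moreover have "Z t \<noteq> 0" if "t \<in> {0<..1}" for t
    proof -
      have "Z t $ 2 = y t" using that by (simp add: Z_def)
      then show ?thesis using y_pos[of t] that by auto
    qed
    moreover have "Z \<in> {0..1} \<rightarrow>\<^sub>E UNIV" by (simp add: Z_def)
    ultimately show ?thesis using solution unfolding reflected_solution_def by blast
  qed
  then have "started.Z ` {0<..<1} \<subseteq> ?Sol" by blast
  moreover have "inj_on started.Z {0<..<1}"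
  proof (rule inj_on_inverseI)
    fix c :: real assume "c \<in> {0<..<1}"
    then interpret started c by unfold_locales auto
    show "Z 1 $ 2 = c" by (simp add: Z_def y_1)
  qed
  moreover have "uncountable {0<..<1::real}" by (simp add: uncountable_open_interval)
  ultimately show "uncountable ?Sol"
    by (meson countable_image_inj_on countable_subset)
qed

end
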